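(* Let $d\ge 2$ and let $E\subset\mathbb R^d$. If $HD(E)>1$, then for almost all $\lambda\in\mathbb R^d$ the set $\Delta_\lambda(E)=\{|\lambda-y| : y\in E\}$ has positive Lebesgue measure.
   Context: $HD$ denotes Hausdorff dimension and $|\cdot|$ the Euclidean norm in $\mathbb R^d$. "Almost all" refers to Lebesgue measure on $\mathbb R^d$. For a point $\lambda\in\mathbb R^d$, $\Delta_\lambda(E)\subset\mathbb R$ is the set of distances from $\lambda$ to all points of $E$.
   Formalization: E is additionally assumed to be analytic (Suslin), which includes all Borel sets; for arbitrary E with HD(E)>1 the distance sets can be non-measurable for every λ, so their Lebesgue measure need not be defined. *)

theory Defs
  imports "HOL-Analysis.Analysis"
begin

text \<open>Since \<open>diameter\<close> is a conditionally complete supremum, it is meaningful only for bounded sets,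
  so covering sets are required to be bounded. Covering sets may be empty, so finite covers are
  included.\<close>

definition hausdorff_premeasure :: "real \<Rightarrow> real \<Rightarrow> 'a::metric_space set \<Rightarrow> ennreal" where
  "hausdorff_premeasure \<delta> s A =
     (INF U \<in> {U :: nat \<Rightarrow> 'a set. A \<subseteq> (\<Union>i. U i) \<and> (\<forall>i. bounded (U i) \<and> diameter (U i) \<le> \<delta>)}.
        \<Sum>i. ennreal (diameter (U i) powr s))"

definition hausdorff_measure :: "real \<Rightarrow> 'a::metric_space set \<Rightarrow> ennreal" where
  "hausdorff_measure s A = (SUP \<delta>\<in>{0<..}. hausdorff_premeasure \<delta> s A)"

text \<open>Only \<open>s > 0\<close> is used: \<open>0 powr 0 = 0\<close> makes \<open>hausdorff_measure 0\<close> differ from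
  counting measure. The exclusion of \<open>s = 0\<close> does not affect the infimum.\<close>

definition hausdorff_dim :: "'a::metric_space set \<Rightarrow> ennreal" where
  "hausdorff_dim A = (INF s \<in> {s. 0 < s \<and> hausdorff_measure s A = 0}. ennreal s)"

definition pinned_distances :: "'a::real_normed_vector \<Rightarrow> 'a set \<Rightarrow> real set" where
  "pinned_distances l E = {norm (l - y) | y. y \<in> E}"

text \<open>Analytic (Suslin) sets: continuous images of the Baire space \<open>nat \<Rightarrow> nat\<close> (product of
  discrete topologies), and the empty set. Every Borel subset of a Polish space is analytic, see
  \<open>borel_imp_analytic\<close> below.

  The theorem is stated for analytic \<open>E\<close>. That the distance set of \<open>E\<close> has a Lebesgue measure at all
  presupposes some regularity of \<open>E\<close>, and the usual convention of geometric measure theory (Borel,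
  or more generally analytic, sets) guarantees it: pinned distance sets of analytic sets are analytic,
  hence Lebesgue measurable. The convention cannot be dropped: under the continuum hypothesis there
  is a set of Hausdorff dimension greater than 1 in the plane all of whose pinned distance sets are
  Lebesgue null.\<close>

definition analytic_set :: "'a::topological_space set \<Rightarrow> bool" where
  "analytic_set A \<longleftrightarrow>
     A = {} \<or> (\<exists>f :: (nat \<Rightarrow> nat) \<Rightarrow> 'a. continuous_on UNIV f \<and> range f = A)"

lemma eventually_agree_baire:
  fixes \<sigma> :: "nat \<Rightarrow> nat"
  shows "\<forall>\<^sub>F \<tau> in at \<sigma>. \<forall>i\<le>n. \<tau> i = \<sigma> i"
proof -
  have *: "\<forall>\<^sub>F \<tau> in at \<sigma>. \<tau> i = \<sigma> i" for i
  proof -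
    have "continuous_on UNIV (\<lambda>\<tau>::nat\<Rightarrow>nat. \<tau> i)"
      by (rule continuous_on_product_coordinates)
    then have "((\<lambda>\<tau>. \<tau> i) \<longlongrightarrow> \<sigma> i) (at \<sigma>)"
      by (simp add: continuous_on_def)
    then show ?thesis
      by (simp add: tendsto_discrete)
  qed
  have "\<forall>\<^sub>F \<tau> in at \<sigma>. \<forall>i\<in>{..n}. \<tau> i = \<sigma> i"
    by (rule eventually_ball_finite) (use * in auto)
  then show ?thesis by (simp add: atMost_iff Ball_def)
qed

lemma continuous_on_reindex:
  fixes r :: "nat \<Rightarrow> nat"
  shows "continuous_on UNIV (\<lambda>\<sigma>::nat\<Rightarrow>nat. \<lambda>k. \<sigma> (r k))"
  by (rule continuous_on_coordinatewise_then_product) (rule continuous_on_product_coordinates)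

lemma analytic_set_image:
  assumes "analytic_set A" "continuous_on A g"
  shows "analytic_set (g ` A)"
proof (cases "A = {}")
  case False
  then obtain f :: "(nat \<Rightarrow> nat) \<Rightarrow> 'a" where f: "continuous_on UNIV f" "range f = A"
    using assms(1) unfolding analytic_set_def by blast
  have "continuous_on UNIV (g \<circ> f)"
    by (rule continuous_on_compose) (use f assms(2) in auto)
  moreover have "range (g \<circ> f) = g ` A" using f(2) by auto
  ultimately show ?thesis unfolding analytic_set_def by blast
qed (simp add: analytic_set_def)

lemma closed_imp_analytic:
  fixes C :: "'a::polish_space set"
  assumes "closed C"
  shows "analytic_set C"
proof (cases "C = {}")
  case True then show ?thesis by (simp add: analytic_set_def)
next
  case False
  obtain D where D: "countable D" "D \<subseteq> C" "C \<subseteq> closure D"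
    using separable by blast
  have "D \<noteq> {}" using D False by auto
  define d where "d = from_nat_into D"
  have rd: "range d = D" unfolding d_def using range_from_nat_into[OF \<open>D \<noteq> {}\<close> D(1)] .
  define x where "x = (\<lambda>(\<sigma>::nat\<Rightarrow>nat). rec_nat (d (\<sigma> 0))
     (\<lambda>k y. if dist (d (\<sigma> (Suc k))) y < (1/2)^k then d (\<sigma> (Suc k)) else y))"
  have x0: "x \<sigma> 0 = d (\<sigma> 0)" for \<sigma> by (simp add: x_def)
  have xS: "x \<sigma> (Suc k) = (if dist (d (\<sigma> (Suc k))) (x \<sigma> k) < (1/2)^k
      then d (\<sigma> (Suc k)) else x \<sigma> k)" for \<sigma> k by (simp add: x_def)
  have xC: "x \<sigma> k \<in> C" for \<sigma> k
    using D(2) rd by (induction k) (auto simp: x0 xS)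
  have step: "dist (x \<sigma> (Suc k)) (x \<sigma> k) \<le> (1/2)^k" for \<sigma> k
    by (auto simp: xS)
  have far: "dist (x \<sigma> (n + m)) (x \<sigma> n) \<le> 2 * (1/2)^n - 2 * (1/2)^(n+m)" for \<sigma> n m
  proof (induction m)
    case (Suc m)
    have "dist (x \<sigma> (n + Suc m)) (x \<sigma> n)
        \<le> dist (x \<sigma> (Suc (n + m))) (x \<sigma> (n+m)) + dist (x \<sigma> (n+m)) (x \<sigma> n)"
      using dist_triangle by simp
    also have "\<dots> \<le> (1/2)^(n+m) + (2 * (1/2)^n - 2 * (1/2)^(n+m))"
      using Suc step by (intro add_mono) auto
    finally show ?case by simp
  qed simp
  have far': "dist (x \<sigma> m) (x \<sigma> n) \<le> 2 * (1/2)^n" if "n \<le> m" for \<sigma> n m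
  proof -
    have "0 \<le> 2 * (1/2::real)^m" by simp
    moreover have "n + (m - n) = m" using that by simp
    then have "dist (x \<sigma> m) (x \<sigma> n) \<le> 2 * (1/2)^n - 2 * (1/2)^m"
      using far[of \<sigma> n "m - n"] by presburger
    ultimately show ?thesis by linarith
  qed
  have small: "\<exists>n. 4 * (1/2::real)^n < e" if "e > 0" for e
  proof -
    have "0 < e/4" "(1/2::real) < 1" using that by auto
    then obtain n where "(1/2::real)^n < e/4" using real_arch_pow_inv by blast
    then have "4 * (1/2::real)^n < e" by linarith
    then show ?thesis ..
  qed
  have "convergent (x \<sigma>)" for \<sigma>
  proof (rule Cauchy_convergent, rule metric_CauchyI)
    fix e :: real assume "e > 0"
    then obtain n where n: "4 * (1/2::real)^n < e" using small by blast
    have "dist (x \<sigma> m) (x \<sigma> k) < e" if "n \<le> m" "n \<le> k" for m k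
      using far'[OF that(1), of \<sigma>] far'[OF that(2), of \<sigma>] dist_triangle2[of "x \<sigma> m" "x \<sigma> k" "x \<sigma> n"] n
      by linarith
    then show "\<exists>M. \<forall>m\<ge>M. \<forall>n\<ge>M. dist (x \<sigma> m) (x \<sigma> n) < e" by blast
  qed
  then have lim: "x \<sigma> \<longlonglongrightarrow> lim (x \<sigma>)" for \<sigma> by (simp add: convergent_LIMSEQ_iff)
  define f where "f = (\<lambda>\<sigma>. lim (x \<sigma>))"
  have fC: "f \<sigma> \<in> C" for \<sigma>
    unfolding f_def using assms lim xC closed_sequentially by blast
  have fx: "dist (f \<sigma>) (x \<sigma> n) \<le> 2 * (1/2)^n" for \<sigma> n
  proof (rule Lim_bounded)
    show "(\<lambda>m. dist (x \<sigma> m) (x \<sigma> n)) \<longlonglongrightarrow> dist (f \<sigma>) (x \<sigma> n)"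
      unfolding f_def by (intro tendsto_intros lim)
    show "\<forall>m\<ge>n. dist (x \<sigma> m) (x \<sigma> n) \<le> 2 * (1/2)^n" using far' by blast
  qed
  have xagree: "x \<tau> n = x \<sigma> n" if "\<forall>i\<le>n. \<tau> i = \<sigma> i" for \<sigma> \<tau> n
    using that by (induction n) (auto simp: x0 xS)
  have "continuous_on UNIV f"
    unfolding continuous_on_def
  proof (intro ballI tendstoI)
    fix \<sigma> :: "nat \<Rightarrow> nat" and e :: real assume "e > 0"
    then obtain n where n: "4 * (1/2::real)^n < e" using small by blast
    have "dist (f \<tau>) (f \<sigma>) < e" if "\<forall>i\<le>n. \<tau> i = \<sigma> i" for \<tau>
      using fx[of \<tau> n] fx[of \<sigma> n] xagree[OF that] n dist_triangle2[of "f \<tau>" "f \<sigma>" "x \<sigma> n"] by simp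
    then show "\<forall>\<^sub>F \<tau> in at \<sigma>. dist (f \<tau>) (f \<sigma>) < e"
      using eventually_agree_baire[of n \<sigma>] by (rule eventually_mono[rotated])
  qed
  moreover have "range f = C"
  proof
    show "range f \<subseteq> C" using fC by blast
    show "C \<subseteq> range f"
    proof
      fix y assume "y \<in> C"
      then have y: "y \<in> closure D" using D by blast
      have "\<exists>k. dist (d k) y < (1/2)^n / 4" for n
      proof -
        have "(0::real) < (1/2)^n / 4" by simp
        with y obtain z where "z \<in> D" "dist z y < (1/2)^n / 4"
          unfolding closure_approachable by blast
        then show ?thesis using rd by (metis imageE)
      qed
      then obtain \<sigma> where \<sigma>: "\<And>n. dist (d (\<sigma> n)) y < (1/2)^n / 4" by metis
      have xd: "x \<sigma> n = d (\<sigma> n)" for n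
      proof (induction n)
        case (Suc n)
        have "dist (d (\<sigma> (Suc n))) (d (\<sigma> n)) < (1/2)^n"
        proof -
          have "(0::real) < (1/2)^n" "(1/2::real)^Suc n = (1/2)^n / 2" by simp_all
          then show ?thesis
            using \<sigma>[of "Suc n"] \<sigma>[of n] dist_triangle2[of "d (\<sigma> (Suc n))" "d (\<sigma> n)" y] by linarith
        qed
        then show ?case by (simp add: xS Suc)
      qed (simp add: x0)
      have "x \<sigma> \<longlonglongrightarrow> y"
      proof (rule metric_LIMSEQ_I)
        fix e :: real assume "e > 0"
        then obtain n where n: "4 * (1/2::real)^n < e" using small by blast
        have "dist (x \<sigma> m) y < e" if "n \<le> m" for m
        proof -
          have "(1/2::real)^m \<le> (1/2)^n" using that by (rule power_decreasing) auto
          moreover have "(0::real) < (1/2)^n" by simp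
          ultimately show ?thesis using \<sigma>[of m] n unfolding xd by linarith
        qed
        then show "\<exists>M. \<forall>m\<ge>M. dist (x \<sigma> m) y < e" by blast
      qed
      then have "f \<sigma> = y" unfolding f_def by (rule limI)
      then show "y \<in> range f" by blast
    qed
  qed
  ultimately show ?thesis unfolding analytic_set_def by blast
qed

lemma closed_baire_imp_analytic:
  fixes C :: "(nat \<Rightarrow> nat) set"
  assumes "closed C"
  shows "analytic_set C"
proof -
  define N where "N = {z :: nat \<Rightarrow> real. \<forall>i. z i \<in> \<nat>}"
  define g where "g = (\<lambda>(z :: nat \<Rightarrow> real) i. nat \<lfloor>z i\<rfloor>)"
  have cn: "continuous_on \<nat> (\<lambda>t::real. nat \<lfloor>t\<rfloor>)"
    unfolding continuous_on_def
  proof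
    fix t :: real assume t: "t \<in> \<nat>"
    have "\<forall>\<^sub>F s in at t within \<nat>. nat \<lfloor>s\<rfloor> = nat \<lfloor>t\<rfloor>"
      unfolding eventually_at
    proof (intro exI[of _ "1::real"] conjI ballI impI)
      fix s :: real assume "s \<in> \<nat>" "s \<noteq> t \<and> dist s t < 1"
      with t show "nat \<lfloor>s\<rfloor> = nat \<lfloor>t\<rfloor>" by (auto simp: Nats_def dist_real_def)
    qed simp
    then show "((\<lambda>t. nat \<lfloor>t\<rfloor>) \<longlongrightarrow> nat \<lfloor>t\<rfloor>) (at t within \<nat>)"
      by (simp add: tendsto_discrete)
  qed
  have cg: "continuous_on N g"
    unfolding g_def
  proof (rule continuous_on_coordinatewise_then_product)
    fix i
    have "continuous_on N (\<lambda>z. z i)"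
      by (rule continuous_on_subset[OF continuous_on_product_coordinates subset_UNIV])
    moreover have "(\<lambda>z. z i) ` N \<subseteq> \<nat>" by (auto simp: N_def)
    ultimately show "continuous_on N (\<lambda>z. nat \<lfloor>z i\<rfloor>)"
      using continuous_on_compose2[OF cn, where f = "\<lambda>z. z i" and s = N] by simp
  qed
  have "closed {z :: nat \<Rightarrow> real. z i \<in> \<nat>}" for i
  proof -
    have "closed ((\<lambda>z :: nat \<Rightarrow> real. z i) -` \<nat>)"
      by (rule closed_vimage[OF closed_Nats continuous_on_product_coordinates])
    then show ?thesis by (simp add: vimage_def)
  qed
  then have "closed N"
    unfolding N_def by (rule closed_Collect_all)
  then have "closed (N \<inter> g -` C)"
    using continuous_closed_preimage[OF cg _ assms] by blast
  then have "analytic_set (N \<inter> g -` C)" by (rule closed_imp_analytic)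
  then have "analytic_set (g ` (N \<inter> g -` C))"
    by (rule analytic_set_image) (rule continuous_on_subset[OF cg Int_lower1])
  moreover have "g ` (N \<inter> g -` C) = C"
  proof -
    have "\<sigma> \<in> g ` (N \<inter> g -` C)" if "\<sigma> \<in> C" for \<sigma>
      using that by (intro image_eqI[of _ _ "\<lambda>i. real (\<sigma> i)"]) (auto simp: g_def N_def)
    then show ?thesis by auto
  qed
  ultimately show ?thesis by simp
qed

lemma analytic_set_UN:
  fixes A :: "nat \<Rightarrow> 'a::topological_space set"
  assumes "\<And>n. analytic_set (A n)"
  shows "analytic_set (\<Union>n. A n)"
proof (cases "\<forall>n. A n = {}")
  case True then show ?thesis by (simp add: analytic_set_def)
next
  case False
  then obtain k where k: "A k \<noteq> {}" by blast
  define B where "B = (\<lambda>n. if A n = {} then A k else A n)"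
  have "\<exists>f :: (nat \<Rightarrow> nat) \<Rightarrow> 'a. continuous_on UNIV f \<and> range f = B n" for n
    using assms[of n] assms[of k] k unfolding analytic_set_def B_def by auto
  then obtain f :: "nat \<Rightarrow> (nat \<Rightarrow> nat) \<Rightarrow> 'a"
    where f: "\<And>n. continuous_on UNIV (f n)" "\<And>n. range (f n) = B n" by metis
  define F where "F = (\<lambda>\<sigma>. f (\<sigma> 0) (\<lambda>k. \<sigma> (Suc k)))"
  have "continuous_on UNIV F"
    unfolding continuous_on_def
  proof
    fix \<sigma> :: "nat \<Rightarrow> nat"
    have "continuous_on UNIV (\<lambda>\<tau>. f (\<sigma> 0) (\<lambda>k. \<tau> (Suc k)))"
      by (rule continuous_on_compose2[OF f(1) continuous_on_reindex]) auto
    then have "((\<lambda>\<tau>. f (\<sigma> 0) (\<lambda>k. \<tau> (Suc k))) \<longlongrightarrow> F \<sigma>) (at \<sigma>)"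
      by (simp add: continuous_on_def F_def)
    moreover have "\<forall>\<^sub>F \<tau> in at \<sigma>. f (\<sigma> 0) (\<lambda>k. \<tau> (Suc k)) = F \<tau>"
      using eventually_agree_baire[of 0 \<sigma>] by eventually_elim (simp add: F_def)
    ultimately show "(F \<longlongrightarrow> F \<sigma>) (at \<sigma>)"
      by (rule Lim_transform_eventually)
  qed
  moreover have "range F = (\<Union>n. B n)"
  proof -
    have "f n \<sigma> \<in> range F" for n \<sigma>
      by (rule image_eqI[of _ _ "case_nat n \<sigma>"]) (auto simp: F_def)
    then have "B n \<subseteq> range F" for n
      unfolding f(2)[of n, symmetric] by blast
    moreover have "F \<sigma> \<in> B (\<sigma> 0)" for \<sigma>
      unfolding f(2)[of "\<sigma> 0", symmetric] F_def by (rule rangeI)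
    ultimately show ?thesis by blast
  qed
  moreover have "(\<Union>n. B n) = (\<Union>n. A n)" by (auto simp: B_def split: if_splits)
  ultimately show ?thesis unfolding analytic_set_def by metis
qed

lemma analytic_set_INT:
  fixes A :: "nat \<Rightarrow> 'a::t2_space set"
  assumes "\<And>n. analytic_set (A n)"
  shows "analytic_set (\<Inter>n. A n)"
proof (cases "\<exists>n. A n = {}")
  case True
  then have "(\<Inter>n. A n) = {}" by blast
  then show ?thesis by (simp add: analytic_set_def)
next
  case False
  then have "\<exists>f :: (nat \<Rightarrow> nat) \<Rightarrow> 'a. continuous_on UNIV f \<and> range f = A n" for n
    using assms[of n] unfolding analytic_set_def by auto
  then obtain f :: "nat \<Rightarrow> (nat \<Rightarrow> nat) \<Rightarrow> 'a"
    where f: "\<And>n. continuous_on UNIV (f n)" "\<And>n. range (f n) = A n" by metis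
  define h where "h = (\<lambda>n \<sigma>. f n (\<lambda>k. \<sigma> (prod_encode (n, k))))"
  have h: "continuous_on UNIV (h n)" for n
    unfolding h_def by (rule continuous_on_compose2[OF f(1) continuous_on_reindex]) auto
  define S where "S = {\<sigma>. \<forall>n. h n \<sigma> = h 0 \<sigma>}"
  have "closed S"
    unfolding S_def by (intro closed_Collect_all closed_Collect_eq h)
  then have "analytic_set (h 0 ` S)"
    by (intro analytic_set_image closed_baire_imp_analytic continuous_on_subset[OF h subset_UNIV])
  moreover have "h 0 ` S = (\<Inter>n. A n)"
  proof (intro equalityI subsetI)
    fix y assume "y \<in> h 0 ` S"
    then obtain \<sigma> where "y = h 0 \<sigma>" "\<sigma> \<in> S" by blast
    then have "y = h n \<sigma>" for n unfolding S_def by (metis (mono_tags, lifting) mem_Collect_eq)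
    then show "y \<in> (\<Inter>n. A n)" using f(2) unfolding h_def by blast
  next
    fix y assume "y \<in> (\<Inter>n. A n)"
    then have "\<forall>n. \<exists>\<sigma>. f n \<sigma> = y" using f(2) by (metis INT_iff UNIV_I imageE)
    then obtain s where s: "\<And>n. f n (s n) = y" by metis
    define \<sigma> where "\<sigma> = (\<lambda>m. case prod_decode m of (n, k) \<Rightarrow> s n k)"
    have "h n \<sigma> = y" for n by (simp add: h_def \<sigma>_def s)
    then show "y \<in> h 0 ` S" unfolding S_def by (intro image_eqI[of _ _ \<sigma>]) auto
  qed
  ultimately show ?thesis by simp
qed

lemma borel_imp_analytic:
  fixes A :: "'a::polish_space set"
  assumes "A \<in> sets borel"
  shows "analytic_set A"
proof -
  have op: "analytic_set U" if "open U" for U :: "'a set"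
  proof -
    have "fsigma_in euclidean U"
      using that metrizable_space_euclidean by (intro open_imp_fsigma_in) auto
    then obtain F :: "nat \<Rightarrow> 'a set" where F: "\<And>n. closed (F n)" "U = (\<Union>n. F n)"
      unfolding fsigma_in_ascending by auto
    then show ?thesis by (simp add: analytic_set_UN closed_imp_analytic)
  qed
  have "A \<in> sigma_sets UNIV {S. open S}" using assms by (simp add: borel_def)
  then have "analytic_set A \<and> analytic_set (- A)"
  proof induction
    case (Basic S)
    then show ?case using op closed_imp_analytic[of "- S"] by auto
  next
    case Empty
    then show ?case using closed_imp_analytic[of "{}"] closed_imp_analytic[of UNIV] by simp
  next
    case (Compl S)
    then show ?case by (simp add: Compl_eq_Diff_UNIV[symmetric])
  next
    case (Union S)
    have "- (\<Union>i. S i) = (\<Inter>i. - S i)" by auto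
    then show ?case using Union.IH analytic_set_UN[of S] analytic_set_INT[of "\<lambda>i. - S i"] by simp
  qed
  then show ?thesis ..
qed

end

theory Submission
  imports Defs
begin

text \<open>
  Suppose first that \<open>E\<close> carries a finite measure \<open>\<mu>\<close> of compact support with mass
  \<open>O(r powr s)\<close> in all balls of radius \<open>r\<close>, for some \<open>s > 1\<close>. Then the energy, the double integral of
  \<open>1 / norm (x - y)\<close>, is finite. For fixed \<open>x\<close> and \<open>y\<close>, the points \<open>l\<close> of a ball whose distances to
  \<open>x\<close> and \<open>y\<close> differ by at most \<open>r\<close> lie in a slab, and so have measure
  \<open>O(r / norm (x - y))\<close> (\<open>emeasure_almost_equidistant_le\<close>). Integrating over \<open>x\<close> and \<open>y\<close>, the
  \<open>(\<mu> \<times> \<mu>)\<close>-measure of the pairs whose distances to \<open>l\<close> differ by at most \<open>r\<close> is \<open>O(r)\<close> on average over \<open>l\<close>;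
  by Fatou's lemma, for almost every \<open>l\<close> it is \<open>O(r)\<close> along a sequence of radii tending to zero. For
  such \<open>l\<close> the distances cannot concentrate on a null set: by the Cauchy-Schwarz inequality,
  intervals of length \<open>r\<close> containing all distances have total length bounded below
  (\<open>square_mass_le_measure_times_collisions\<close>).

  The limit measure \<open>\<mu>\<close> can be avoided. The argument works with finitely many point masses at each
  dyadic scale, as long as the total mass is bounded above and below uniformly and the ball condition
  holds down to that scale. Such masses exist near a compact set \<open>K\<close> as soon as all neighbourhoods of
  \<open>K\<close> have dyadic net content bounded below: this is a finite form of Frostman's lemma
  (\<open>finite_frostman\<close>).

  It remains to find such a \<open>K\<close> in \<open>E\<close>. Since the dimension is greater than 1, some Hausdorff
  measure of exponent \<open>s > 1\<close> is positive on \<open>E\<close>, hence so is the dyadic net content of that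
  exponent. Net content is continuous along increasing sequences of arbitrary sets
  (\<open>net_content_incseq\<close>), and for set functions of this kind an analytic set contains compact sets all
  of whose neighbourhoods are almost as large as the set (\<open>capacity_inner_compact\<close>). The same principle, applied to outer
  Lebesgue measure, shows that analytic sets are Lebesgue measurable; the pinned distance sets are
  analytic, being continuous images of \<open>E\<close>.
\<close>

section \<open>Inner approximation of analytic sets by compact sets\<close>

lemma tendsto_fun_iff:
  fixes X :: "'b \<Rightarrow> 'i \<Rightarrow> 'a::topological_space"
  shows "(X \<longlongrightarrow> l) F \<longleftrightarrow> (\<forall>i. ((\<lambda>n. X n i) \<longlongrightarrow> l i) F)"
  using limitin_componentwise[of "\<lambda>_::'i. euclidean :: 'a topology" UNIV X l F]
  by (simp add: euclidean_product_topology limitin_canonical_iff)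

text \<open>Choquet's capacitability argument. Since \<open>c\<close> is continuous along increasing sequences, the
  coordinates of the Baire space can be bounded one after the other, each by a bound so large that
  the image of what remains still has capacity above \<open>t\<close>. All bounds together cut out a compact
  product, whose image is \<open>K\<close>. The set \<open>K\<close> itself may have small capacity, because nothing is
  assumed about decreasing sequences; but an open set around \<open>K\<close> already contains the image of a
  set in which finitely many coordinates are bounded, and those images are large by construction.\<close>

lemma capacity_inner_compact:
  fixes f :: "(nat \<Rightarrow> nat) \<Rightarrow> 'a::topological_space" and c :: "'a set \<Rightarrow> 'b::complete_linorder"
  assumes f: "continuous_on UNIV f"
    and mono: "\<And>A B. A \<subseteq> B \<Longrightarrow> c A \<le> c B"
    and up: "\<And>A. incseq A \<Longrightarrow> c (\<Union>i::nat. A i) \<le> (SUP i. c (A i))"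
    and t: "t < c (range f)"
  obtains K where "compact K" "K \<subseteq> range f" "\<And>V. open V \<Longrightarrow> K \<subseteq> V \<Longrightarrow> t < c V"
proof -
  define C where "C m n = {\<sigma> :: nat \<Rightarrow> nat. \<forall>i<n. \<sigma> i \<le> m i}" for m :: "nat \<Rightarrow> nat" and n :: nat
  have "\<exists>b. \<forall>n. t < c (f ` C (b n) n) \<and> (\<forall>i<n. b (Suc n) i = b n i)"
  proof (rule dependent_nat_choice)
    show "\<exists>m. t < c (f ` C m 0)"
      using t by (simp add: C_def)
  next
    fix m n assume m: "t < c (f ` C m n)"
    have "incseq (\<lambda>j. f ` C (m(n := j)) (Suc n))"
      by (intro monoI image_mono) (auto simp: C_def less_Suc_eq all_conj_distrib)
    moreover have "(\<Union>j. C (m(n := j)) (Suc n)) = C m n"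
      unfolding C_def by (force simp: less_Suc_eq)
    then have "(\<Union>j. f ` C (m(n := j)) (Suc n)) = f ` C m n"
      by (simp flip: image_UN)
    ultimately have "c (f ` C m n) \<le> (SUP j. c (f ` C (m(n := j)) (Suc n)))"
      using up by metis
    with m obtain j where "t < c (f ` C (m(n := j)) (Suc n))"
      by (metis (no_types, lifting) less_SUP_iff order_less_le_trans)
    then show "\<exists>m'. t < c (f ` C m' (Suc n)) \<and> (\<forall>i<n. m' i = m i)"
      by (intro exI[of _ "m(n := j)"]) auto
  qed
  \<comment> \<open>Bounds that were chosen once are kept, so the diagonal below collects all of them.\<close>
  then obtain b where b: "\<And>n. t < c (f ` C (b n) n)" and b_eq: "\<And>n i. i < n \<Longrightarrow> b (Suc n) i = b n i"
    by blast
  define m where "m i = b (Suc i) i" for i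
  have bm: "b n i = m i" if "i < n" for n i
    using that
  proof (induction n)
    case (Suc n)
    then show ?case using b_eq[of i n] by (cases "i = n") (auto simp: m_def)
  qed simp
  have bigm: "t < c (f ` C m n)" for n
  proof -
    have "C (b n) n = C m n" using bm by (auto simp: C_def)
    then show ?thesis using b[of n] by simp
  qed
  define P where "P = PiE UNIV (\<lambda>i. {..m i})"
  have P: "P = {\<sigma>. \<forall>i. \<sigma> i \<le> m i}" by (auto simp: P_def PiE_def Pi_def)
  have "compactin (product_topology (\<lambda>i::nat. euclidean :: nat topology) UNIV) P"
    unfolding P_def compactin_PiE by (simp add: compactin_euclidean_iff finite_imp_compact)
  then have compP: "compact P"
    by (simp add: euclidean_product_topology compactin_euclidean_iff)
  show ?thesis
  proof
    show "compact (f ` P)"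
      by (rule compact_continuous_image[OF continuous_on_subset[OF f] compP]) simp
    show "f ` P \<subseteq> range f" by blast
    fix V :: "'a set" assume V: "open V" "f ` P \<subseteq> V"
    have opn: "open (f -` V)" using open_vimage[OF V(1) f] .
    have "\<exists>n. C m n \<subseteq> f -` V"
    proof (rule ccontr)
      assume "\<not> ?thesis"
      then have "\<exists>\<sigma>. \<sigma> \<in> C m n \<and> f \<sigma> \<notin> V" for n by auto
      then obtain \<sigma> where s: "\<And>n. \<sigma> n \<in> C m n" "\<And>n. f (\<sigma> n) \<notin> V" by metis
      \<comment> \<open>Truncating \<open>\<sigma> n\<close> by \<open>m\<close> changes only coordinates from \<open>n\<close> on.\<close>
      define \<tau> where "\<tau> n = (\<lambda>i. min (\<sigma> n i) (m i))" for n
      have "\<tau> n \<in> P" for n by (auto simp: \<tau>_def P)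
      then obtain l r where l: "l \<in> P" "strict_mono r" "(\<tau> \<circ> r) \<longlonglongrightarrow> l"
        using compact_imp_seq_compact[OF compP] unfolding seq_compact_def by meson
      have "(\<lambda>n. \<sigma> (r n)) \<longlonglongrightarrow> l"
      unfolding tendsto_fun_iff
      proof
        fix i
        have "(\<lambda>n. (\<tau> \<circ> r) n i) \<longlonglongrightarrow> l i" using l(3) unfolding tendsto_fun_iff by blast
        moreover have "\<forall>\<^sub>F n in sequentially. (\<tau> \<circ> r) n i = \<sigma> (r n) i"
          using eventually_gt_at_top[of i]
        proof eventually_elim
          case (elim n)
          then have "i < r n" using seq_suble[OF l(2), of n] by simp
          then show ?case using s(1)[of "r n"] by (simp add: \<tau>_def C_def)
        qed
        ultimately show "(\<lambda>n. \<sigma> (r n) i) \<longlonglongrightarrow> l i"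
          by (rule Lim_transform_eventually)
      qed
      moreover have "l \<in> f -` V" using l(1) V(2) by blast
      ultimately have "\<forall>\<^sub>F n in sequentially. \<sigma> (r n) \<in> f -` V"
        using topological_tendstoD[OF _ opn] by blast
      then show False using s(2) by (auto simp: eventually_sequentially)
    qed
    then obtain n where "f ` C m n \<subseteq> V" by blast
    then show "t < c V" using bigm[of n] mono by (meson order_less_le_trans)
  qed
qed

text \<open>Outer Lebesgue measure is continuous along increasing sequences of arbitrary sets, and for compact
  sets it is the infimum over open neighbourhoods. By the preceding lemma, an analytic set of finite
  outer measure is therefore exhausted, up to a null set, by countably many compact subsets.\<close>

lemma analytic_set_imp_lebesgue:
  fixes A :: "'a::euclidean_space set"
  assumes "analytic_set A"
  shows "A \<in> sets lebesgue"
proof -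
  have bdd: "B \<in> sets lebesgue" if B: "analytic_set B" "outer_measure_of lborel B < \<infinity>" for B :: "'a set"
  proof (cases "B = {}")
    case False
    then obtain f :: "(nat \<Rightarrow> nat) \<Rightarrow> 'a" where f: "continuous_on UNIV f" "range f = B"
      using B(1) unfolding analytic_set_def by blast
    let ?c = "outer_measure_of lborel"
    have inner: "\<exists>K. compact K \<and> K \<subseteq> B \<and> t \<le> emeasure lborel K" if t: "t < ?c B" for t
    proof -
      obtain K where K: "compact K" "K \<subseteq> range f" "\<And>V. open V \<Longrightarrow> K \<subseteq> V \<Longrightarrow> t < ?c V"
      proof (rule capacity_inner_compact[OF f(1), of "?c" t])
        show "?c X \<le> ?c Y" if "X \<subseteq> Y" for X Y :: "'a set" using that by (rule outer_measure_of_mono)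
        show "?c (\<Union>i. X i) \<le> (SUP i. ?c (X i))" if "incseq X" for X :: "nat \<Rightarrow> 'a set"
          using SUP_outer_measure_of_incseq[of X lborel] that by simp
        show "t < ?c (range f)" using t f by simp
      qed blast
      have Kb: "K \<in> sets borel" using K(1) by (rule borel_compact)
      have "t \<le> emeasure lborel K + e" if e: "e > 0" for e :: real
      proof -
        obtain U where U: "open U" "K \<subseteq> U" "emeasure lborel (U - K) < e"
          using outer_regular_lborel[OF Kb e] by blast
        have "t \<le> emeasure lborel U" using K(3)[OF U(1,2)] U(1) by simp
        also have "U = K \<union> (U - K)" using U(2) by blast
        also have "emeasure lborel (K \<union> (U - K)) \<le> emeasure lborel K + emeasure lborel (U - K)"
          using Kb U(1) by (intro emeasure_subadditive) auto
        also have "\<dots> \<le> emeasure lborel K + e" using U(3) by (intro add_left_mono) auto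
        finally show ?thesis .
      qed
      then have "t \<le> emeasure lborel K" by (rule ennreal_le_epsilon)
      then show ?thesis using K f by auto
    qed
    obtain G where G: "G \<in> sets lborel" "B \<subseteq> G" "?c B = emeasure lborel G"
      using outer_measure_of_attain[of B lborel] by auto
    define \<K> where "\<K> = {K. compact K \<and> K \<subseteq> B}"
    have "?c B \<le> (SUP K\<in>\<K>. emeasure lborel K)"
    proof (rule dense_le)
      fix t assume "t < ?c B"
      with inner obtain K where "K \<in> \<K>" "t \<le> emeasure lborel K" unfolding \<K>_def by blast
      then show "t \<le> (SUP K\<in>\<K>. emeasure lborel K)" by (meson SUP_upper2)
    qed
    moreover have "\<K> \<noteq> {}" unfolding \<K>_def by auto
    then obtain h :: "nat \<Rightarrow> ennreal" where h: "range h \<subseteq> emeasure lborel ` \<K>"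
        "(SUP K\<in>\<K>. emeasure lborel K) = (SUP n. h n)"
      using ennreal_Sup_countable_SUP[of "emeasure lborel ` \<K>"] by auto
    then have "\<forall>n. \<exists>K\<in>\<K>. h n = emeasure lborel K" by blast
    then obtain K where K: "\<And>n. K n \<in> \<K>" "\<And>n. h n = emeasure lborel (K n)" by metis
    define L where "L = (\<Union>n. K n)"
    have L: "L \<in> sets borel" "L \<subseteq> B"
      using K(1) unfolding L_def \<K>_def by (blast intro: borel_compact)+
    have "h n \<le> emeasure lborel L" for n
      unfolding K(2) using L(1) by (intro emeasure_mono) (auto simp: L_def)
    ultimately have "emeasure lborel G \<le> emeasure lborel L"
      unfolding G(3)[symmetric] h(2) by (meson SUP_least order_trans)
    then have "emeasure lborel (G - L) = 0"
    proof (subst emeasure_Diff)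
      have "emeasure lborel L \<le> emeasure lborel G" using G(1,2) L(2) by (intro emeasure_mono) auto
      then show "emeasure lborel L \<noteq> \<infinity>" using B(2) unfolding G(3) by (auto simp: top_unique)
    qed (use G(1,2) L B(2) G(3) in \<open>auto simp: diff_eq_0_iff_ennreal\<close>)
    then have "G - L \<in> null_sets lborel" using G L by auto
    then have "B - L \<in> null_sets lebesgue"
      using G(2) by (intro null_sets_completion_subset[of "B - L" "G - L"] null_sets_completionI) auto
    then have "B - L \<in> sets lebesgue" by auto
    moreover have "L \<in> sets lebesgue" using L(1) by auto
    ultimately have "L \<union> (B - L) \<in> sets lebesgue" by (rule sets.Un[rotated])
    then show ?thesis using L(2) by (simp add: Un_absorb1)
  qed auto
  have "A \<inter> cball 0 (real n) \<in> sets lebesgue" for n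
  proof (rule bdd)
    have "analytic_set (\<Inter>k::nat. if k = 0 then A else cball 0 (real n))"
      using assms closed_imp_analytic[OF closed_cball] by (intro analytic_set_INT) auto
    also have "(\<Inter>k::nat. if k = 0 then A else cball 0 (real n)) = A \<inter> cball 0 (real n)"
      by (auto split: if_splits)
    finally show "analytic_set (A \<inter> cball 0 (real n))" .
    have "outer_measure_of lborel (A \<inter> cball 0 (real n)) \<le> outer_measure_of lborel (cball (0::'a) (real n))"
      by (rule outer_measure_of_mono) auto
    also have "\<dots> < \<infinity>" using emeasure_compact_finite[OF compact_cball, of "0::'a" "real n"] by simp
    finally show "outer_measure_of lborel (A \<inter> cball 0 (real n)) < \<infinity>" .
  qed
  then have "(\<Union>n. A \<inter> cball 0 (real n)) \<in> sets lebesgue" by blast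
  moreover have "(\<Union>n. A \<inter> cball 0 (real n)) = A"
    using real_arch_simple by auto
  ultimately show ?thesis by simp
qed

section \<open>Net content of a refining sequence of partitions\<close>

text \<open>A sequence of partitions is encoded by labels: \<open>g k x\<close> names the cell of level \<open>k\<close> that contains
  \<open>x\<close>. A cell is addressed by its level and its label, since the weight of a cell depends on its
  level and a set may be a cell of several levels.\<close>

definition refining :: "(nat \<Rightarrow> 'a \<Rightarrow> 'z) \<Rightarrow> bool" where
  "refining g \<longleftrightarrow> (\<forall>j k x y. j \<le> k \<longrightarrow> g k x = g k y \<longrightarrow> g j x = g j y)"

definition cell :: "(nat \<Rightarrow> 'a \<Rightarrow> 'z) \<Rightarrow> nat \<times> 'z \<Rightarrow> 'a set" where
  "cell g q = {x. g (fst q) x = snd q}"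

text \<open>The weights of the cells form a measure \<open>\<nu>\<close> on the addresses, so that the total weight of a
  family of cells is the measure of a set of addresses. Unlike Hausdorff content with arbitrary
  covering sets, net content is continuous along increasing sequences by an elementary argument.\<close>

definition net_content :: "(nat \<Rightarrow> 'a \<Rightarrow> 'z) \<Rightarrow> (nat \<times> 'z) measure \<Rightarrow> 'a set \<Rightarrow> ennreal" where
  "net_content g \<nu> A = (INF S\<in>{S. A \<subseteq> (\<Union>q\<in>S. cell g q)}. emeasure \<nu> S)"

lemma net_content_le: "A \<subseteq> (\<Union>q\<in>S. cell g q) \<Longrightarrow> net_content g \<nu> A \<le> emeasure \<nu> S"
  unfolding net_content_def by (rule INF_lower) simp

lemma net_content_mono: "A \<subseteq> B \<Longrightarrow> net_content g \<nu> A \<le> net_content g \<nu> B"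
  unfolding net_content_def by (rule INF_superset_mono) auto

lemma net_content_near_cover:
  assumes "net_content g \<nu> A < \<infinity>" "e > 0"
  obtains S where "A \<subseteq> (\<Union>q\<in>S. cell g q)" "emeasure \<nu> S \<le> net_content g \<nu> A + e"
proof -
  have "net_content g \<nu> A < net_content g \<nu> A + e"
    using assms by (cases "net_content g \<nu> A"; cases e) (auto simp flip: ennreal_plus simp: ennreal_less_iff)
  then show ?thesis
    using that unfolding net_content_def INF_less_iff by (auto intro: less_imp_le)
qed

text \<open>If the part of \<open>A\<close> that \<open>S'\<close> covers had a much cheaper cover, then exchanging \<open>S'\<close> for it
  would improve \<open>S\<close> by more than \<open>e\<close>.\<close>

lemma near_cover_subfamily:
  assumes "sets \<nu> = UNIV" and A: "A \<subseteq> (\<Union>q\<in>S. cell g q)"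
    and fin: "net_content g \<nu> A < \<infinity>" and S: "emeasure \<nu> S \<le> net_content g \<nu> A + e" and e: "e < \<infinity>"
    and "S' \<subseteq> S"
  shows "emeasure \<nu> S' \<le> net_content g \<nu> (A \<inter> (\<Union>q\<in>S'. cell g q)) + e"
proof (cases "net_content g \<nu> (A \<inter> (\<Union>q\<in>S'. cell g q)) < \<infinity>")
  case True
  have split: "emeasure \<nu> S = emeasure \<nu> S' + emeasure \<nu> (S - S')"
    using assms by (subst plus_emeasure) (auto intro!: arg_cong[where f="emeasure \<nu>"])
  have "emeasure \<nu> S < \<infinity>"
    using fin S e by (simp add: less_top[symmetric] top_unique) (metis ennreal_add_eq_top top.extremum_unique)
  then have rest: "emeasure \<nu> (S - S') < \<infinity>"
    using split by (simp add: less_top[symmetric])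
  have "net_content g \<nu> A \<le> net_content g \<nu> (A \<inter> (\<Union>q\<in>S'. cell g q)) + emeasure \<nu> (S - S')"
  proof (rule ennreal_le_epsilon)
    fix d :: real assume "0 < d"
    then obtain T where T: "A \<inter> (\<Union>q\<in>S'. cell g q) \<subseteq> (\<Union>q\<in>T. cell g q)"
        "emeasure \<nu> T \<le> net_content g \<nu> (A \<inter> (\<Union>q\<in>S'. cell g q)) + ennreal d"
      using net_content_near_cover[OF True, of "ennreal d"] by auto
    have "net_content g \<nu> A \<le> emeasure \<nu> (T \<union> (S - S'))"
    proof (rule net_content_le, rule subsetI)
      fix x assume "x \<in> A"
      then obtain q where "q \<in> S" "x \<in> cell g q" using A by auto
      then show "x \<in> (\<Union>q\<in>T \<union> (S - S'). cell g q)"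
        using T(1) \<open>x \<in> A\<close> by (cases "q \<in> S'") auto
    qed
    also have "\<dots> \<le> emeasure \<nu> T + emeasure \<nu> (S - S')"
      using assms(1) by (intro emeasure_subadditive) auto
    also have "\<dots> \<le> net_content g \<nu> (A \<inter> (\<Union>q\<in>S'. cell g q)) + ennreal d + emeasure \<nu> (S - S')"
      using T(2) by (intro add_right_mono)
    finally show "net_content g \<nu> A \<le> net_content g \<nu> (A \<inter> (\<Union>q\<in>S'. cell g q)) + emeasure \<nu> (S - S') + ennreal d"
      by (simp add: ac_simps)
  qed
  then have "emeasure \<nu> S \<le> net_content g \<nu> (A \<inter> (\<Union>q\<in>S'. cell g q)) + emeasure \<nu> (S - S') + e"
    using S by (meson add_right_mono order_trans)
  then have "emeasure \<nu> (S - S') + emeasure \<nu> S'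
      \<le> emeasure \<nu> (S - S') + (net_content g \<nu> (A \<inter> (\<Union>q\<in>S'. cell g q)) + e)"
    unfolding split by (simp add: ac_simps)
  then show ?thesis
    using rest unfolding ennreal_add_left_cancel_le by auto
next
  case False
  then have "net_content g \<nu> (A \<inter> (\<Union>q\<in>S'. cell g q)) = \<infinity>" by (simp add: less_top[symmetric])
  then show ?thesis by simp
qed

text \<open>Choose nearly optimal covers \<open>U i\<close> of \<open>A i\<close>. The maximal cells of all these families together
  cover the union, and the point is that their total weight is hardly more than the weight of a
  single \<open>U i\<close>. Among maximal cells that stem from \<open>U 0\<close>, \<dots>, \<open>U i\<close>, those of \<open>U i\<close> count
  in \<open>U i\<close> anyway; over each other one, a cell \<open>q\<close> of an earlier \<open>U j\<close>, the cells of \<open>U i\<close>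
  below \<open>q\<close> cover the part of \<open>A j\<close> in \<open>q\<close>, so by near optimality of \<open>U j\<close> they weigh almost as
  much as \<open>q\<close> does.\<close>

lemma net_content_incseq:
  assumes g: "refining g" and \<nu>: "sets \<nu> = UNIV" and inc: "incseq A"
  shows "net_content g \<nu> (\<Union>i::nat. A i) \<le> (SUP i. net_content g \<nu> (A i))"
proof (cases "(SUP i. net_content g \<nu> (A i)) < \<infinity>")
  case True
  have fin: "net_content g \<nu> (A i) < \<infinity>" for i
    using True by (meson SUP_lessD UNIV_I)
  show ?thesis
  proof (rule ennreal_le_epsilon)
    fix d :: real assume d: "0 < d"
    define \<epsilon> where "\<epsilon> i = ennreal (d * (1/2)^Suc i)" for i
    have "\<exists>S. A i \<subseteq> (\<Union>q\<in>S. cell g q) \<and> emeasure \<nu> S \<le> net_content g \<nu> (A i) + \<epsilon> i" for i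
      by (rule net_content_near_cover[OF fin[of i], of "\<epsilon> i"]) (use d in \<open>auto simp: \<epsilon>_def\<close>)
    then obtain U where U: "\<And>i. A i \<subseteq> (\<Union>q\<in>U i. cell g q)"
        "\<And>i. emeasure \<nu> (U i) \<le> net_content g \<nu> (A i) + \<epsilon> i" by metis
    define T where "T = (\<Union>i. U i)"
    \<comment> \<open>The cells of \<open>T\<close> that lie in no cell of \<open>T\<close> of a smaller level.\<close>
    define mx where "mx = {(k, g k x) | k x. (k, g k x) \<in> T \<and> (\<forall>j<k. (j, g j x) \<notin> T)}"
    define under where "under G = {(k, g k x) | k x. \<exists>j\<le>k. (j, g j x) \<in> G}" for G
    have ref: "g j x = g j y" if "g k x = g k y" "j \<le> k" for j k x y
      using g that unfolding refining_def by blast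
    have mxD: "(j, g j x) \<notin> T" if kx: "(k, g k x) \<in> mx" and jk: "j < k" for j k x
    proof -
      obtain y where y: "g k x = g k y" "\<forall>j<k. (j, g j y) \<notin> T"
        using kx unfolding mx_def by auto
      then show ?thesis using ref[OF y(1), of j] jk by simp
    qed
    have mxT: "mx \<subseteq> T" by (auto simp: mx_def)
    \<comment> \<open>Maximal cells from the first families are paid for, up to the errors so far, by the cells of
      \<open>U i\<close> that they contain.\<close>
    have key: "emeasure \<nu> G \<le> emeasure \<nu> (U i \<inter> under G) + (\<Sum>j<i. \<epsilon> j)"
      if "G \<subseteq> mx" "G \<subseteq> (\<Union>j\<le>i. U j)" for G i
      using that
    proof (induction i arbitrary: G)
      case 0
      have "G \<subseteq> under G" using 0(1) by (force simp: under_def mx_def)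
      then show ?case using 0 \<nu> by (auto intro!: emeasure_mono)
    next
      case (Suc i)
      define F where "F = G \<inter> U (Suc i)"
      define G' where "G' = G - F"
      define R where "R = U i \<inter> under G'"
      have "G' \<subseteq> (\<Union>j\<le>i. U j)" using Suc.prems(2) by (auto simp: G'_def F_def atMost_Suc)
      then have IH: "emeasure \<nu> G' \<le> emeasure \<nu> R + (\<Sum>j<i. \<epsilon> j)"
        using Suc.prems(1) unfolding R_def by (intro Suc.IH) (auto simp: G'_def)
      \<comment> \<open>A cell of \<open>U (Suc i)\<close> that meets a maximal cell is contained in it, so the part of \<open>A i\<close> in
        the cells of \<open>G'\<close> is covered by cells of \<open>U (Suc i)\<close> below \<open>G'\<close>.\<close>
      have "A i \<inter> (\<Union>q\<in>R. cell g q) \<subseteq> (\<Union>q\<in>U (Suc i) \<inter> under G'. cell g q)"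
      proof
        fix x assume x: "x \<in> A i \<inter> (\<Union>q\<in>R. cell g q)"
        then obtain k y j where "g k x = g k y" "j \<le> k" "(j, g j y) \<in> G'"
          unfolding R_def under_def cell_def by auto
        then have j: "(j, g j x) \<in> G'" using ref by metis
        have "x \<in> A (Suc i)" using x incseq_SucD[OF inc] by blast
        then obtain l where l: "(l, g l x) \<in> U (Suc i)"
          using U(1)[of "Suc i"] unfolding cell_def by force
        have "(j, g j x) \<in> mx" using j Suc.prems(1) by (auto simp: G'_def)
        then have "j \<le> l" using mxD[of j x l] l by (force simp: T_def)
        then have "(l, g l x) \<in> U (Suc i) \<inter> under G'" using l j by (auto simp: under_def)
        then show "x \<in> (\<Union>q\<in>U (Suc i) \<inter> under G'. cell g q)" by (force simp: cell_def)
      qed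
      then have "net_content g \<nu> (A i \<inter> (\<Union>q\<in>R. cell g q)) \<le> emeasure \<nu> (U (Suc i) \<inter> under G')"
        by (rule net_content_le)
      moreover have "emeasure \<nu> R \<le> net_content g \<nu> (A i \<inter> (\<Union>q\<in>R. cell g q)) + \<epsilon> i"
        by (rule near_cover_subfamily[OF \<nu> U(1) fin U(2)]) (auto simp: R_def \<epsilon>_def)
      ultimately have "emeasure \<nu> R \<le> emeasure \<nu> (U (Suc i) \<inter> under G') + \<epsilon> i"
        by (meson add_right_mono order_trans)
      then have "emeasure \<nu> R + (\<Sum>j<i. \<epsilon> j) \<le> emeasure \<nu> (U (Suc i) \<inter> under G') + \<epsilon> i + (\<Sum>j<i. \<epsilon> j)"
        by (rule add_right_mono)
      also have "\<dots> = emeasure \<nu> (U (Suc i) \<inter> under G') + (\<Sum>j<Suc i. \<epsilon> j)"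
        by (simp add: ac_simps)
      finally have G': "emeasure \<nu> G' \<le> emeasure \<nu> (U (Suc i) \<inter> under G') + (\<Sum>j<Suc i. \<epsilon> j)"
        using IH by (rule order_trans[rotated])
      have disj: "F \<inter> (U (Suc i) \<inter> under G') = {}"
      proof (rule ccontr)
        assume "\<not> ?thesis"
        then obtain k x j where k: "(k, g k x) \<in> F" "j \<le> k" "(j, g j x) \<in> G'"
          unfolding under_def by auto
        have "(k, g k x) \<in> mx" "(j, g j x) \<in> T"
          using k(1,3) Suc.prems(1) mxT by (auto simp: F_def G'_def)
        then have "j = k" using mxD k(2) le_neq_implies_less by blast
        with k show False by (auto simp: G'_def)
      qed
      have FG: "F \<subseteq> under G"
        using Suc.prems(1) by (force simp: F_def under_def mx_def)
      have "emeasure \<nu> G = emeasure \<nu> F + emeasure \<nu> G'"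
        using \<nu> by (subst plus_emeasure) (auto simp: G'_def F_def intro!: arg_cong[where f="emeasure \<nu>"])
      also have "\<dots> \<le> emeasure \<nu> F + emeasure \<nu> (U (Suc i) \<inter> under G') + (\<Sum>j<Suc i. \<epsilon> j)"
        unfolding add.assoc using G' by (rule add_left_mono)
      also have "emeasure \<nu> F + emeasure \<nu> (U (Suc i) \<inter> under G') = emeasure \<nu> (F \<union> (U (Suc i) \<inter> under G'))"
        using \<nu> disj by (intro plus_emeasure) auto
      also have "\<dots> \<le> emeasure \<nu> (U (Suc i) \<inter> under G)"
        using \<nu> FG by (intro emeasure_mono) (auto simp: F_def G'_def under_def)
      finally show ?case by (simp add: add_right_mono)
    qed
    have eps: "(\<Sum>j<i. \<epsilon> j) + \<epsilon> i \<le> ennreal d" for i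
    proof -
      have "(\<Sum>j<i. \<epsilon> j) + \<epsilon> i = (\<Sum>j<Suc i. \<epsilon> j)" by simp
      also have "\<dots> = ennreal (\<Sum>j<Suc i. d * (1/2)^Suc j)"
        unfolding \<epsilon>_def using d by (intro sum_ennreal) auto
      also have "(\<Sum>j<Suc i. d * (1/2)^Suc j) = d * (1 - (1/2)^Suc i)"
        by (induction i) (auto simp: field_simps)
      also have "ennreal \<dots> \<le> ennreal d"
        using d by (intro ennreal_leI) (simp add: mult_le_cancel_left1)
      finally show ?thesis .
    qed
    define Q where "Q i = mx \<inter> (\<Union>j\<le>i. U j)" for i
    have Qi: "emeasure \<nu> (Q i) \<le> (SUP i. net_content g \<nu> (A i)) + ennreal d" for i
    proof -
      have "emeasure \<nu> (Q i) \<le> emeasure \<nu> (U i \<inter> under (Q i)) + (\<Sum>j<i. \<epsilon> j)"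
        by (rule key) (auto simp: Q_def)
      also have "\<dots> \<le> emeasure \<nu> (U i) + (\<Sum>j<i. \<epsilon> j)"
        using \<nu> by (intro add_right_mono emeasure_mono) auto
      also have "\<dots> \<le> net_content g \<nu> (A i) + \<epsilon> i + (\<Sum>j<i. \<epsilon> j)"
        using U(2) by (intro add_right_mono)
      also have "\<dots> = net_content g \<nu> (A i) + ((\<Sum>j<i. \<epsilon> j) + \<epsilon> i)" by (simp add: ac_simps)
      also have "\<dots> \<le> (SUP i. net_content g \<nu> (A i)) + ennreal d"
        by (intro add_mono eps SUP_upper) auto
      finally show ?thesis .
    qed
    have "(\<Union>i. A i) \<subseteq> (\<Union>q\<in>mx. cell g q)"
    proof
      fix x assume "x \<in> (\<Union>i. A i)"
      then obtain i where "x \<in> A i" by blast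
      then obtain k where "(k, g k x) \<in> T"
        using U(1)[of i] unfolding cell_def T_def by force
      then have "\<exists>k. (k, g k x) \<in> T \<and> (\<forall>j<k. (j, g j x) \<notin> T)"
        using exists_least_iff[of "\<lambda>k. (k, g k x) \<in> T"] by blast
      then show "x \<in> (\<Union>q\<in>mx. cell g q)" by (force simp: mx_def cell_def)
    qed
    then have "net_content g \<nu> (\<Union>i. A i) \<le> emeasure \<nu> mx" by (rule net_content_le)
    also have "mx = (\<Union>i. Q i)" using mxT by (auto simp: Q_def T_def)
    also have "emeasure \<nu> (\<Union>i. Q i) = (SUP i. emeasure \<nu> (Q i))"
      using \<nu> by (intro SUP_emeasure_incseq[symmetric]) (auto simp: Q_def incseq_def intro: order_trans)
    also have "\<dots> \<le> (SUP i. net_content g \<nu> (A i)) + ennreal d"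
      using Qi by (rule SUP_least)
    finally show "net_content g \<nu> (\<Union>i. A i) \<le> (SUP i. net_content g \<nu> (A i)) + ennreal d" .
  qed
next
  case False
  then have "(SUP i. net_content g \<nu> (A i)) = top"
    unfolding infinity_ennreal_def less_top[symmetric] by blast
  then show ?thesis by (metis top_greatest)
qed

section \<open>Frostman weights at a finite scale\<close>

definition level_weight :: "(nat \<Rightarrow> real) \<Rightarrow> (nat \<times> 'z) measure" where
  "level_weight a = density (count_space UNIV) (\<lambda>q. ennreal (a (fst q)))"

lemma sets_level_weight: "sets (level_weight a) = UNIV"
  by (simp add: level_weight_def)

lemma emeasure_level_weight_finite:
  assumes "finite S" "\<And>k. a k \<ge> 0"
  shows "emeasure (level_weight a) S = ennreal (\<Sum>q\<in>S. a (fst q))"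
proof -
  have "emeasure (level_weight a) S = (\<integral>\<^sup>+q. ennreal (a (fst q)) \<partial>count_space S)"
    unfolding level_weight_def
    by (subst emeasure_density) (auto simp: nn_integral_count_space_indicator intro!: nn_integral_cong split: split_indicator)
  also have "\<dots> = (\<Sum>q\<in>S. ennreal (a (fst q)))"
    by (rule nn_integral_count_space_finite) fact
  finally show ?thesis using assms(2) by (simp add: sum_ennreal)
qed

text \<open>A finite-scale Frostman lemma. Put the mass \<open>a n\<close> on one point of each cell of level \<open>n\<close> that
  meets \<open>V\<close>, and go from level \<open>n\<close> down to level \<open>0\<close>, scaling the mass down in each cell that
  carries more than \<open>a k\<close>. In the end no cell carries too much, and every point lies in a cell that
  carries exactly the mass allowed: the last one in which its mass was reduced, or else its cell of
  level \<open>n\<close>. The largest such cells are disjoint and cover \<open>V\<close>, so the total mass is the weight of a cover.\<close>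

lemma finite_frostman:
  fixes g :: "nat \<Rightarrow> 'a \<Rightarrow> 'z" and a :: "nat \<Rightarrow> real"
  assumes g: "refining g" and fin: "finite (g n ` V)" and a: "\<And>k. a k > 0"
  obtains X w where "finite X" "X \<subseteq> V" "\<And>x. x \<in> X \<Longrightarrow> w x \<ge> 0"
    "\<And>k z. k \<le> n \<Longrightarrow> (\<Sum>x | x \<in> X \<and> g k x = z. w x) \<le> a k"
    "net_content g (level_weight a) V \<le> ennreal (\<Sum>x\<in>X. w x)"
proof -
  have ref: "g j x = g j y" if "g k x = g k y" "j \<le> k" for j k x y
    using g that unfolding refining_def by blast
  obtain X where X: "X \<subseteq> V" "inj_on (g n) X" "g n ` V = g n ` X"
    using subset_image_inj[of "g n ` V" "g n" V] by auto
  have finX: "finite X" using fin X(2,3) by (simp add: finite_image_iff)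
  define m where "m w k z = (\<Sum>x | x \<in> X \<and> g k x = z. w x)" for w :: "'a \<Rightarrow> real" and k z
  \<comment> \<open>The state after the levels \<open>k\<close>, \<dots>, \<open>n\<close> have been treated.\<close>
  define P where "P k \<longleftrightarrow> (\<exists>w. (\<forall>x\<in>X. w x \<ge> 0) \<and> (\<forall>j\<in>{k..n}. \<forall>z. m w j z \<le> a j)
      \<and> (\<forall>x\<in>X. \<exists>j\<in>{k..n}. m w j (g j x) = a j))" for k
  have "P 0"
  proof (rule inc_induct[of 0 n P])
    show "(0::nat) \<le> n" by simp
    have single: "{x' \<in> X. g n x' = g n x} = {x}" if "x \<in> X" for x
      using X(2) that by (auto simp: inj_on_def)
    have "m (\<lambda>_. a n) n z \<le> a n" for z
    proof (cases "z \<in> g n ` X")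
      case True
      then show ?thesis using single by (auto simp: m_def)
    next
      case False
      then have "{x \<in> X. g n x = z} = {}" by auto
      then show ?thesis using a[of n] unfolding m_def by (metis sum.empty less_imp_le)
    qed
    then show "P n"
      unfolding P_def using a[of n] single by (intro exI[of _ "\<lambda>_. a n"]) (auto simp: m_def)
  next
    fix k assume k: "k < n" "P (Suc k)"
    then obtain w where w: "\<And>x. x \<in> X \<Longrightarrow> w x \<ge> 0" "\<And>j z. j \<in> {Suc k..n} \<Longrightarrow> m w j z \<le> a j"
        "\<And>x. x \<in> X \<Longrightarrow> \<exists>j\<in>{Suc k..n}. m w j (g j x) = a j" unfolding P_def by blast
    define \<theta> where "\<theta> z = (if m w k z \<le> a k then 1 else a k / m w k z)" for z
    define w' where "w' x = \<theta> (g k x) * w x" for x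
    have \<theta>: "0 \<le> \<theta> z" "\<theta> z \<le> 1" for z
      using a[of k] by (auto simp: \<theta>_def)
    have w': "0 \<le> w' x" "w' x \<le> w x" if "x \<in> X" for x
      using \<theta> w(1)[OF that] by (auto simp: w'_def intro: mult_left_le_one_le)
    have mk: "m w' k z = \<theta> z * m w k z" for z
      unfolding m_def sum_distrib_left by (rule sum.cong) (auto simp: w'_def)
    have le: "m w' j z \<le> a j" if j: "j \<in> {k..n}" for j z
    proof (cases "j = k")
      case True
      have "\<theta> z * m w k z \<le> a k" using a[of k] by (auto simp: \<theta>_def)
      then show ?thesis using True mk by simp
    next
      case False
      have "m w' j z \<le> m w j z" unfolding m_def by (rule sum_mono) (use w' in auto)
      also have "\<dots> \<le> a j" using w(2) j False by auto
      finally show ?thesis .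
    qed
    have sat: "\<exists>j\<in>{k..n}. m w' j (g j x) = a j" if x: "x \<in> X" for x
    proof (cases "m w k (g k x) \<le> a k")
      case True
      obtain j where j: "j \<in> {Suc k..n}" "m w j (g j x) = a j" using w(3)[OF x] by blast
      \<comment> \<open>The cell at level \<open>j\<close> lies in a cell of level \<open>k\<close> whose mass is not changed.\<close>
      have "m w' j (g j x) = m w j (g j x)"
        unfolding m_def
      proof (rule sum.cong)
        fix y assume "y \<in> {y \<in> X. g j y = g j x}"
        then have "g k y = g k x" using ref[of j y x k] j(1) by auto
        then show "w' y = w y" using True by (simp add: w'_def \<theta>_def)
      qed simp
      then show ?thesis using j by (intro bexI[of _ j]) auto
    next
      case False
      then have "m w' k (g k x) = a k" using a[of k] by (simp add: mk \<theta>_def)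
      then show ?thesis using k(1) by (intro bexI[of _ k]) auto
    qed
    show "P k"
      unfolding P_def using w'(1) le sat by blast
  qed
  then obtain w where "\<forall>x\<in>X. w x \<ge> 0" "\<forall>j\<in>{0..n}. \<forall>z. m w j z \<le> a j"
      "\<forall>x\<in>X. \<exists>j\<in>{0..n}. m w j (g j x) = a j" unfolding P_def by blast
  then have w: "\<And>x. x \<in> X \<Longrightarrow> w x \<ge> 0" "\<And>j z. j \<le> n \<Longrightarrow> m w j z \<le> a j"
      "\<And>x. x \<in> X \<Longrightarrow> \<exists>j\<le>n. m w j (g j x) = a j" by (simp_all add: Bex_def)
  \<comment> \<open>The level of the largest saturated cell around \<open>x\<close>.\<close>
  define J where "J x = (LEAST j. j \<le> n \<and> m w j (g j x) = a j)" for x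
  have J: "J x \<le> n" "m w (J x) (g (J x) x) = a (J x)" if "x \<in> X" for x
    using w(3)[OF that] LeastI_ex[of "\<lambda>j. j \<le> n \<and> m w j (g j x) = a j"] unfolding J_def by auto
  have Jle: "J x \<le> j" if "j \<le> n" "m w j (g j x) = a j" for x j
    unfolding J_def using that by (intro Least_le) auto
  define \<phi> where "\<phi> x = (J x, g (J x) x)" for x
  have same: "\<phi> u = \<phi> x" if x: "x \<in> X" "u \<in> X" "g (J x) u = g (J x) x" for x u
  proof -
    have "J u \<le> J x" using Jle[of "J x" u] J[OF x(1)] x(3) by simp
    moreover from this have "J x \<le> J u"
      using Jle[of "J u" x] J[OF x(2)] ref[OF x(3), of "J u"] by simp
    ultimately show ?thesis using x(3) by (simp add: \<phi>_def)
  qed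
  have "(\<Sum>q\<in>\<phi> ` X. a (fst q)) = (\<Sum>q\<in>\<phi> ` X. \<Sum>x | x \<in> X \<and> \<phi> x = q. w x)"
  proof (rule sum.cong)
    fix q assume "q \<in> \<phi> ` X"
    then obtain x where x: "x \<in> X" "q = \<phi> x" by blast
    have "{u \<in> X. \<phi> u = q} = {u \<in> X. g (J x) u = g (J x) x}"
      using same[OF x(1)] x(2) by (auto simp: \<phi>_def)
    then show "a (fst q) = (\<Sum>x | x \<in> X \<and> \<phi> x = q. w x)"
      using J(2)[OF x(1)] x(2) by (simp add: m_def \<phi>_def)
  qed simp
  also have "\<dots> = (\<Sum>x\<in>X. w x)" using sum.image_gen[OF finX, of w \<phi>] by simp
  finally have total: "(\<Sum>q\<in>\<phi> ` X. a (fst q)) = (\<Sum>x\<in>X. w x)" .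
  have "V \<subseteq> (\<Union>q\<in>\<phi> ` X. cell g q)"
  proof
    fix v assume "v \<in> V"
    then obtain x where x: "x \<in> X" "g n v = g n x" using X(3) by blast
    then have "g (J x) v = g (J x) x" using ref J(1) by blast
    then show "v \<in> (\<Union>q\<in>\<phi> ` X. cell g q)" using x(1) by (auto simp: cell_def \<phi>_def)
  qed
  then have "net_content g (level_weight a) V \<le> emeasure (level_weight a) (\<phi> ` X)"
    by (rule net_content_le)
  also have "\<dots> = ennreal (\<Sum>x\<in>X. w x)"
    using finX a by (subst emeasure_level_weight_finite) (auto simp: total less_imp_le)
  finally show ?thesis
    using that[of X w] finX X(1) w(1,2) unfolding m_def by blast
qed

section \<open>Dyadic cubes and Hausdorff measure\<close>

definition dyadic :: "nat \<Rightarrow> real ^ 'd \<Rightarrow> int ^ 'd" where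
  "dyadic k x = (\<chi> i. \<lfloor>2 ^ k * x $ i\<rfloor>)"

lemma dyadic_nth: "dyadic k x $ i = \<lfloor>2 ^ k * x $ i\<rfloor>"
  by (simp add: dyadic_def)

lemma refining_dyadic: "refining dyadic"
  unfolding refining_def
proof (intro allI impI)
  fix j k :: nat and x y :: "real ^ 'd"
  assume jk: "j \<le> k" and eq: "dyadic k x = dyadic k y"
  have "dyadic j u $ i = dyadic k u $ i div 2 ^ (k - j)" for u :: "real ^ 'd" and i
  proof -
    have "(2::real) ^ k = 2 ^ j * 2 ^ (k - j)" using jk by (simp flip: power_add)
    then have "2 ^ j * u $ i = (2 ^ k * u $ i) / real (2 ^ (k - j))" by simp
    then show ?thesis
      using floor_divide_real_eq_div[of "2 ^ (k - j)" "2 ^ k * u $ i"] by (simp add: dyadic_nth)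
  qed
  then show "dyadic j x = dyadic j y" using eq by (simp add: vec_eq_iff)
qed

lemma finite_vec_box:
  assumes "finite A"
  shows "finite {z :: 'a ^ 'd. \<forall>i. z $ i \<in> A}"
proof (rule finite_subset)
  show "{z :: 'a ^ 'd. \<forall>i. z $ i \<in> A} \<subseteq> vec_lambda ` (PiE UNIV (\<lambda>_. A))"
    by (auto intro!: image_eqI[of _ _ "vec_nth _"])
  show "finite (vec_lambda ` (PiE UNIV (\<lambda>_::'d. A)))"
    using assms by (intro finite_imageI finite_PiE) auto
qed

lemma finite_dyadic_image:
  assumes "bounded (V :: (real ^ 'd) set)"
  shows "finite (dyadic k ` V)"
proof -
  obtain B where B: "\<And>x. x \<in> V \<Longrightarrow> norm x \<le> B"
    using assms unfolding bounded_iff by blast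
  let ?N = "\<lceil>2 ^ k * B\<rceil> + 1"
  have "dyadic k x $ i \<in> {-?N..?N}" if "x \<in> V" for x i
  proof -
    have "\<bar>x $ i\<bar> \<le> B" using component_le_norm_cart[of x i] B[OF that] by linarith
    then have "\<bar>2 ^ k * x $ i\<bar> \<le> 2 ^ k * B" by (simp add: abs_mult)
    then show ?thesis unfolding dyadic_nth by simp linarith
  qed
  then have "dyadic k ` V \<subseteq> {z. \<forall>i. z $ i \<in> {-?N..?N}}" by auto
  moreover have "finite {z :: int ^ 'd. \<forall>i. z $ i \<in> {-?N..?N}}"
    by (rule finite_vec_box) simp
  ultimately show ?thesis by (rule finite_subset)
qed

lemma diameter_dyadic_cell:
  fixes q :: "nat \<times> (int ^ 'd)"
  shows "bounded (cell dyadic q)" "diameter (cell dyadic q) \<le> CARD('d) * (1/2) ^ fst q"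
proof -
  have d: "norm (x - y) \<le> CARD('d) * (1/2) ^ fst q" if "x \<in> cell dyadic q" "y \<in> cell dyadic q" for x y
  proof -
    have "\<bar>x $ i - y $ i\<bar> \<le> (1/2) ^ fst q" for i
    proof -
      have "\<lfloor>2 ^ fst q * x $ i\<rfloor> = \<lfloor>2 ^ fst q * y $ i\<rfloor>"
        using that unfolding cell_def by (simp flip: dyadic_nth)
      then have "\<bar>2 ^ fst q * x $ i - 2 ^ fst q * y $ i\<bar> \<le> 1" by linarith
      then have "2 ^ fst q * \<bar>x $ i - y $ i\<bar> \<le> 1" by (simp add: abs_mult flip: right_diff_distrib)
      then show ?thesis by (simp add: field_simps)
    qed
    then have "(\<Sum>i\<in>UNIV. \<bar>(x - y) $ i\<bar>) \<le> (\<Sum>i\<in>(UNIV::'d set). (1/2) ^ fst q)"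
      by (intro sum_mono) simp
    then show ?thesis using norm_le_l1_cart[of "x - y"] by simp
  qed
  show "bounded (cell dyadic q)"
    unfolding bounded_two_points dist_norm using d by blast
  show "diameter (cell dyadic q) \<le> CARD('d) * (1/2) ^ fst q"
    by (rule diameter_le) (use d in auto)
qed

text \<open>A family of cubes of small total weight consists of small cubes only. It is therefore admissible
  for the Hausdorff premeasure at a given \<open>\<delta>\<close>, where a cube of level \<open>k\<close> costs its weight up to a
  constant, since its diameter is at most a multiple of \<open>(1/2) ^ k\<close>.\<close>

lemma net_content_pos_if_hausdorff_measure_pos:
  fixes E :: "(real ^ 'd) set"
  assumes "hausdorff_measure s E > 0" and s: "s > 0"
  shows "net_content dyadic (level_weight (\<lambda>k. (1/2) powr (s * k))) E > 0"
proof (rule ccontr)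
  let ?\<nu> = "level_weight (\<lambda>k. (1/2) powr (s * k)) :: (nat \<times> (int ^ 'd)) measure"
  let ?D = "real CARD('d)"
  assume "\<not> ?thesis"
  then have zero: "net_content dyadic ?\<nu> E = 0" by simp
  obtain \<delta> where \<delta>: "\<delta> > 0" "hausdorff_premeasure \<delta> s E > 0"
    using assms(1) unfolding hausdorff_measure_def less_SUP_iff by auto
  have "hausdorff_premeasure \<delta> s E \<le> 0 + ennreal e" if e: "e > 0" for e :: real
  proof -
    \<comment> \<open>The first bound keeps the total below \<open>e\<close>, the second forces all diameters below \<open>\<delta>\<close>.\<close>
    define \<epsilon> where "\<epsilon> = min (e / ?D powr s) ((\<delta> / ?D) powr s)"
    have \<epsilon>: "\<epsilon> > 0" "?D powr s * \<epsilon> \<le> e" "\<epsilon> \<le> (\<delta> / ?D) powr s"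
      using e \<delta>(1) by (auto simp: \<epsilon>_def min_def field_simps)
    have "net_content dyadic ?\<nu> E < ennreal \<epsilon>" using zero \<epsilon>(1) by simp
    then obtain S where S: "E \<subseteq> (\<Union>q\<in>S. cell dyadic q)" "emeasure ?\<nu> S < ennreal \<epsilon>"
      unfolding net_content_def INF_less_iff by auto
    have w: "emeasure ?\<nu> {q} = ennreal ((1/2) powr (s * fst q))" for q
      by (subst emeasure_level_weight_finite) auto
    have bound: "?D * (1/2) ^ fst q \<le> \<delta>" if q: "q \<in> S" for q
    proof -
      have "ennreal ((1/2) powr (s * fst q)) \<le> emeasure ?\<nu> S"
        unfolding w[symmetric] by (rule emeasure_mono) (use q in \<open>auto simp: sets_level_weight\<close>)
      then have "(1/2) powr (s * fst q) < \<epsilon>"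
        using S(2) by (metis ennreal_less_iff order_le_less_trans powr_ge_zero)
      then have "((1/2) ^ fst q) powr s < (\<delta> / ?D) powr s"
        using \<epsilon>(3) by (simp add: powr_powr mult.commute flip: powr_realpow)
      then have "(1/2) ^ fst q \<le> \<delta> / ?D"
        using s by (metis less_le_not_le linorder_le_cases powr_mono2 \<delta>(1) divide_nonneg_nonneg less_imp_le of_nat_0_le_iff)
      then show ?thesis by (simp add: field_simps)
    qed
    \<comment> \<open>The Hausdorff premeasure sums over sequences: list the cubes by their codes and insert the empty
      set for all other numbers.\<close>
    define T where "T n = {q \<in> S. to_nat q = n}" for n
    have T: "T n = {} \<or> (\<exists>q\<in>S. T n = {q})" for n
      unfolding T_def by auto
    define U where "U n = (\<Union>q\<in>T n. cell dyadic q)" for n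
    have U: "bounded (U n)" "diameter (U n) \<le> \<delta>"
        "ennreal (diameter (U n) powr s) \<le> ennreal (?D powr s) * emeasure ?\<nu> (T n)" for n
    proof -
      consider "T n = {}" | q where "q \<in> S" "T n = {q}" using T by blast
      then have "bounded (U n) \<and> diameter (U n) \<le> \<delta> \<and>
        ennreal (diameter (U n) powr s) \<le> ennreal (?D powr s) * emeasure ?\<nu> (T n)"
      proof cases
        case 1
        then show ?thesis using \<delta>(1) by (simp add: U_def)
      next
        case 2
        have Un: "U n = cell dyadic q" using 2 by (simp add: U_def)
        note d = diameter_dyadic_cell[of q]
        have "diameter (U n) powr s \<le> (?D * (1/2) ^ fst q) powr s"
          unfolding Un using d s by (intro powr_mono2) (auto intro: diameter_ge_0)
        also have "\<dots> = ?D powr s * (1/2) powr (s * fst q)"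
          by (simp add: powr_mult powr_powr mult.commute flip: powr_realpow)
        finally have "ennreal (diameter (U n) powr s) \<le> ennreal (?D powr s) * emeasure ?\<nu> (T n)"
          using 2 w by (simp add: ennreal_leI flip: ennreal_mult)
        then show ?thesis using Un d bound[OF 2(1)] by auto
      qed
      then show "bounded (U n)" "diameter (U n) \<le> \<delta>"
        "ennreal (diameter (U n) powr s) \<le> ennreal (?D powr s) * emeasure ?\<nu> (T n)" by auto
    qed
    have "E \<subseteq> (\<Union>n. U n)" using S(1) by (fastforce simp: U_def T_def)
    then have "hausdorff_premeasure \<delta> s E \<le> (\<Sum>n. ennreal (diameter (U n) powr s))"
      unfolding hausdorff_premeasure_def using U(1,2) by (intro INF_lower) auto
    also have "\<dots> \<le> (\<Sum>n. ennreal (?D powr s) * emeasure ?\<nu> (T n))"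
      by (intro suminf_le U) auto
    also have "\<dots> = ennreal (?D powr s) * (\<Sum>n. emeasure ?\<nu> (T n))"
      by simp
    also have "(\<Sum>n. emeasure ?\<nu> (T n)) = emeasure ?\<nu> (\<Union>n. T n)"
      by (rule suminf_emeasure) (auto simp: sets_level_weight T_def disjoint_family_on_def)
    also have "(\<Union>n. T n) = S" by (auto simp: T_def)
    also have "ennreal (?D powr s) * emeasure ?\<nu> S \<le> ennreal (?D powr s) * ennreal \<epsilon>"
      using S(2) by (intro mult_left_mono) auto
    also have "\<dots> \<le> ennreal e" using \<epsilon> by (simp add: ennreal_leI flip: ennreal_mult)
    finally show ?thesis by simp
  qed
  then have "hausdorff_premeasure \<delta> s E \<le> 0" by (rule ennreal_le_epsilon)
  then show False using \<delta>(2) by simp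
qed

section \<open>Points that are almost equidistant from two given points\<close>

text \<open>A packing argument: translates of the part of the slab in the ball by multiples of \<open>3 * h\<close> in the
  direction of \<open>u\<close> are disjoint, and about \<open>R / (3 * h)\<close> of them fit into the ball of twice the
  radius.\<close>

lemma emeasure_cball_slab_le:
  fixes u :: "'a::euclidean_space"
  assumes u: "norm u = 1" and h: "h > 0" and R: "R > 0"
  shows "emeasure lborel {l \<in> cball 0 R. \<bar>inner l u - a\<bar> \<le> h}
    \<le> ennreal (3 * h / R) * emeasure lborel (cball (0::'a) (2 * R))"
proof -
  let ?S = "{l \<in> cball 0 R. \<bar>inner l u - a\<bar> \<le> h}"
  \<comment> \<open>Rounding up is harmless: the last shift, by \<open>3 * h * (N - 1)\<close>, is still less than \<open>R\<close>.\<close>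
  define N where "N = nat \<lceil>R / (3 * h)\<rceil>"
  define S where "S m = (+) ((3 * h * real m) *\<^sub>R u) ` ?S" for m
  have N: "R / (3 * h) \<le> real N" unfolding N_def using h R by simp
  have "closed {l. \<bar>inner l u - a\<bar> \<le> h}"
    by (intro closed_Collect_le continuous_intros)
  then have "compact (cball 0 R \<inter> {l. \<bar>inner l u - a\<bar> \<le> h})"
    by (intro compact_Int_closed) auto
  then have "compact ?S" by (simp add: Int_def)
  then have Sb: "S m \<in> sets borel" for m
    unfolding S_def by (intro borel_compact compact_translation)
  have Sin: "\<bar>inner l u - a - 3 * h * real m\<bar> \<le> h" if "l \<in> S m" for l m
    using that u by (auto simp: S_def inner_add_left norm_eq_1)
  have disj: "disjoint_family_on S {..<N}"
    unfolding disjoint_family_on_def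
  proof (intro ballI impI)
    fix m n :: nat assume "m \<noteq> n"
    show "S m \<inter> S n = {}"
    proof (rule ccontr)
      assume "S m \<inter> S n \<noteq> {}"
      then obtain l where "l \<in> S m" "l \<in> S n" by blast
      from Sin[OF this(1)] Sin[OF this(2)] have "\<bar>3 * h * real m - 3 * h * real n\<bar> \<le> 2 * h" by linarith
      then have "(3 * h) * \<bar>real m - real n\<bar> \<le> (3 * h) * (2 / 3)"
        using h by (simp add: abs_mult flip: right_diff_distrib)
      then have "\<bar>real m - real n\<bar> \<le> 2 / 3" using h by (subst (asm) mult_le_cancel_left_pos) auto
      then show False using \<open>m \<noteq> n\<close> by linarith
    qed
  qed
  have sub: "S m \<subseteq> cball 0 (2 * R)" if "m < N" for m
  proof
    fix l assume "l \<in> S m"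
    then obtain v where v: "norm v \<le> R" "l = (3 * h * real m) *\<^sub>R u + v" by (auto simp: S_def)
    have "real m < R / (3 * h)" using that unfolding N_def by linarith
    then have "3 * h * real m \<le> R" using h by (simp add: field_simps)
    then have "norm ((3 * h * real m) *\<^sub>R u) \<le> R" using u h by simp
    then show "l \<in> cball 0 (2 * R)"
      using v norm_triangle_ineq[of "(3 * h * real m) *\<^sub>R u" v] by simp
  qed
  have "emeasure lborel (S m) = emeasure lborel ?S" for m
  proof -
    have "emeasure lborel (S m) = emeasure (distr lborel borel ((+) ((3 * h * real m) *\<^sub>R u))) (S m)"
      by (simp add: lborel_distr_plus)
    also have "\<dots> = emeasure lborel ((+) ((3 * h * real m) *\<^sub>R u) -` S m)"
      using Sb by (subst emeasure_distr) auto
    also have "(+) ((3 * h * real m) *\<^sub>R u) -` S m = ?S"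
      unfolding S_def by (rule inj_vimage_image_eq) simp
    finally show ?thesis .
  qed
  then have "of_nat N * emeasure lborel ?S = (\<Sum>m<N. emeasure lborel (S m))"
    by simp
  also have "\<dots> = emeasure lborel (\<Union>m<N. S m)"
    using disj Sb by (intro sum_emeasure) auto
  also have "\<dots> \<le> emeasure lborel (cball (0::'a) (2 * R))"
    using sub by (intro emeasure_mono) auto
  finally have le: "of_nat N * emeasure lborel ?S \<le> emeasure lborel (cball (0::'a) (2 * R))" .
  have "emeasure lborel ?S = ennreal (3 * h / R) * (ennreal (R / (3 * h)) * emeasure lborel ?S)"
    using h R by (simp flip: mult.assoc ennreal_mult)
  also have "\<dots> \<le> ennreal (3 * h / R) * (of_nat N * emeasure lborel ?S)"
    using N by (intro mult_left_mono mult_right_mono) (auto simp: ennreal_of_nat_eq_real_of_nat intro: ennreal_leI)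
  also have "\<dots> \<le> ennreal (3 * h / R) * emeasure lborel (cball (0::'a) (2 * R))"
    using le by (rule mult_left_mono) simp
  finally show ?thesis .
qed

text \<open>The difference of the squares of the two distances is an affine function of \<open>l\<close> with gradient of
  length \<open>2 * norm (x - y)\<close>, and it is at most \<open>4 * R * r\<close>. Hence the points in question lie in a slab
  of width proportional to \<open>r / norm (x - y)\<close>, orthogonal to \<open>x - y\<close>.\<close>

lemma emeasure_almost_equidistant_le:
  fixes x y :: "'a::euclidean_space"
  assumes x: "norm x \<le> R" and y: "norm y \<le> R" and xy: "x \<noteq> y" and r: "r > 0" and R: "R > 0"
  shows "emeasure lborel {l \<in> cball 0 R. \<bar>norm (l - x) - norm (l - y)\<bar> \<le> r}
    \<le> ennreal (6 * r / norm (x - y)) * emeasure lborel (cball (0::'a) (2 * R))"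
proof -
  define D where "D = norm (y - x)"
  have D: "D > 0" using xy by (simp add: D_def)
  define u where "u = (y - x) /\<^sub>R D"
  define a where "a = ((norm y)\<^sup>2 - (norm x)\<^sup>2) / (2 * D)"
  have u: "norm u = 1" using D by (simp add: u_def D_def)
  have "{l \<in> cball 0 R. \<bar>norm (l - x) - norm (l - y)\<bar> \<le> r}
      \<subseteq> {l \<in> cball 0 R. \<bar>inner l u - a\<bar> \<le> 2 * R * r / D}"
  proof (intro subsetI CollectI conjI)
    fix l assume l: "l \<in> {l \<in> cball 0 R. \<bar>norm (l - x) - norm (l - y)\<bar> \<le> r}"
    then show "l \<in> cball 0 R" by simp
    have sq: "2 * D * (inner l u - a) = (norm (l - x))\<^sup>2 - (norm (l - y))\<^sup>2"
      using D by (simp add: u_def a_def power2_norm_eq_inner inner_diff inner_commute field_simps)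
    have "norm (l - x) \<le> 2 * R" "norm (l - y) \<le> 2 * R"
      using l x y norm_triangle_ineq4[of l x] norm_triangle_ineq4[of l y] by auto
    then have "\<bar>norm (l - x) - norm (l - y)\<bar> * (norm (l - x) + norm (l - y)) \<le> r * (4 * R)"
      using l r by (intro mult_mono) auto
    moreover have "\<bar>2 * D * (inner l u - a)\<bar> = \<bar>norm (l - x) - norm (l - y)\<bar> * (norm (l - x) + norm (l - y))"
      unfolding sq power2_eq_square square_diff_square_factored by (simp add: abs_mult mult.commute)
    ultimately have "2 * D * \<bar>inner l u - a\<bar> \<le> r * (4 * R)" using D by (simp add: abs_mult)
    then show "\<bar>inner l u - a\<bar> \<le> 2 * R * r / D" using D by (simp add: field_simps)
  qed
  then have "emeasure lborel {l \<in> cball 0 R. \<bar>norm (l - x) - norm (l - y)\<bar> \<le> r}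
      \<le> emeasure lborel {l \<in> cball 0 R. \<bar>inner l u - a\<bar> \<le> 2 * R * r / D}"
    by (rule emeasure_mono) measurable
  also have "\<dots> \<le> ennreal (3 * (2 * R * r / D) / R) * emeasure lborel (cball (0::'a) (2 * R))"
    using R r D by (intro emeasure_cball_slab_le u) auto
  also have "3 * (2 * R * r / D) / R = 6 * r / norm (x - y)"
    using R by (simp add: D_def norm_minus_commute)
  finally show ?thesis .
qed

section \<open>Collisions of distances\<close>

text \<open>For the measure \<open>\<mu>\<close> with point masses \<open>w x\<close>, this is the quotient of
  \<open>(\<mu> \<times> \<mu>) {(x, y). \<bar>p x - p y\<bar> \<le> r}\<close> by \<open>r\<close>. It stands in for the squared \<open>L\<^sup>2\<close> norm of the density
  of the image of \<open>\<mu>\<close> under \<open>p\<close>.\<close>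

definition collisions :: "real \<Rightarrow> 'a set \<Rightarrow> ('a \<Rightarrow> real) \<Rightarrow> ('a \<Rightarrow> real) \<Rightarrow> real" where
  "collisions r X w p = 1 / r * (\<Sum>x\<in>X. \<Sum>y\<in>X. if \<bar>p x - p y\<bar> \<le> r then w x * w y else 0)"

text \<open>Divide the line into intervals of length \<open>r\<close>. By the Cauchy-Schwarz inequality, the squared total
  mass is at most the number of occupied intervals times the sum of the squares of their masses.
  Two points in one interval collide, and the occupied intervals are disjoint subsets of \<open>B\<close>.\<close>

lemma square_mass_le_measure_times_collisions:
  fixes p :: "'a \<Rightarrow> real" and w :: "'a \<Rightarrow> real"
  assumes X: "finite X" and w: "\<And>x. x \<in> X \<Longrightarrow> w x \<ge> 0" and r: "r > 0"
    and B: "B \<in> sets borel" "\<And>x. x \<in> X \<Longrightarrow> {p x - r..p x + r} \<subseteq> B"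
  shows "ennreal ((\<Sum>x\<in>X. w x)\<^sup>2)
    \<le> emeasure lborel B * ennreal (collisions r X w p)"
proof -
  define c where "c x = \<lfloor>p x / r\<rfloor>" for x
  define W where "W j = (\<Sum>x | x \<in> X \<and> c x = j. w x)" for j
  define Q where "Q = (\<Sum>x\<in>X. \<Sum>y\<in>X. if \<bar>p x - p y\<bar> \<le> r then w x * w y else 0)"
  have Q0: "Q \<ge> 0" unfolding Q_def by (intro sum_nonneg) (auto intro: mult_nonneg_nonneg w)
  have "(\<Sum>j\<in>c ` X. (W j)\<^sup>2) = (\<Sum>j\<in>c ` X. \<Sum>x | x \<in> X \<and> c x = j. w x * W (c x))"
    by (rule sum.cong) (auto simp: W_def power2_eq_square sum_distrib_right)
  also have "\<dots> = (\<Sum>x\<in>X. w x * W (c x))"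
    by (rule sum.image_gen[OF X, symmetric])
  also have "\<dots> = (\<Sum>x\<in>X. \<Sum>y\<in>X. if c y = c x then w x * w y else 0)"
    unfolding W_def sum_distrib_left using X by (subst sum.inter_filter) auto
  also have "\<dots> \<le> Q"
    unfolding Q_def
  proof (intro sum_mono)
    fix x y assume "x \<in> X" "y \<in> X"
    moreover have "\<bar>p x - p y\<bar> \<le> r" if "c y = c x"
    proof -
      have "\<bar>p x / r - p y / r\<bar> \<le> 1" using that unfolding c_def by linarith
      then show ?thesis using r by (simp add: field_simps flip: diff_divide_distrib)
    qed
    ultimately show "(if c y = c x then w x * w y else 0) \<le> (if \<bar>p x - p y\<bar> \<le> r then w x * w y else 0)"
      using w by auto
  qed
  finally have sq: "(\<Sum>j\<in>c ` X. (W j)\<^sup>2) \<le> Q" .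
  have "(\<Sum>x\<in>X. w x) = (\<Sum>j\<in>c ` X. 1 * W j)"
    unfolding W_def using sum.image_gen[OF X, of w c] by simp
  also have "(\<dots>)\<^sup>2 \<le> (\<Sum>j\<in>c ` X. 1\<^sup>2) * (\<Sum>j\<in>c ` X. (W j)\<^sup>2)"
    by (rule Cauchy_Schwarz_ineq_sum)
  also have "\<dots> \<le> card (c ` X) * Q"
    using sq by (simp add: mult_left_mono)
  finally have cs: "(\<Sum>x\<in>X. w x)\<^sup>2 \<le> card (c ` X) * Q" .
  define I where "I j = {of_int j * r..<(of_int j + 1) * r}" for j
  have Ic: "t \<in> I j \<longleftrightarrow> \<lfloor>t / r\<rfloor> = j" for t j
    using r by (auto simp: I_def floor_eq_iff field_simps)
  have "ennreal (card (c ` X) * r) = (\<Sum>j\<in>c ` X. emeasure lborel (I j))"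
    using r by (simp add: I_def algebra_simps ennreal_mult ennreal_of_nat_eq_real_of_nat)
  also have "\<dots> = emeasure lborel (\<Union>j\<in>c ` X. I j)"
  proof (rule sum_emeasure)
    show "disjoint_family_on I (c ` X)"
      unfolding disjoint_family_on_def by (auto simp: Ic)
  qed (use X in \<open>auto simp: I_def\<close>)
  also have "\<dots> \<le> emeasure lborel B"
  proof (rule emeasure_mono)
    show "(\<Union>j\<in>c ` X. I j) \<subseteq> B"
    proof
      fix t assume "t \<in> (\<Union>j\<in>c ` X. I j)"
      then obtain x where x: "x \<in> X" "t \<in> I (c x)" by auto
      then have "\<lfloor>t / r\<rfloor> = \<lfloor>p x / r\<rfloor>" unfolding Ic c_def by simp
      then have "\<bar>t / r - p x / r\<bar> \<le> 1" by linarith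
      then have "\<bar>t - p x\<bar> \<le> r" using r by (simp add: field_simps flip: diff_divide_distrib)
      then show "t \<in> B" using B(2)[OF x(1)] by (auto simp: abs_le_iff)
    qed
  qed (use B(1) in simp)
  finally have card: "ennreal (card (c ` X) * r) \<le> emeasure lborel B" .
  have "ennreal ((\<Sum>x\<in>X. w x)\<^sup>2) \<le> ennreal (card (c ` X) * r) * ennreal (1 / r * Q)"
    using cs r Q0 by (subst ennreal_mult[symmetric]) (auto intro!: ennreal_leI)
  also have "\<dots> \<le> emeasure lborel B * ennreal (1 / r * Q)"
    using card by (rule mult_right_mono) simp
  finally show ?thesis unfolding Q_def collisions_def .
qed

text \<open>This splits the kernel \<open>1 / norm (x - y)\<close> into dyadic scales, at each of which the mass bound for
  cubes can be applied.\<close>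

lemma inverse_le_sum_dyadic:
  fixes t :: real
  assumes "t > (1/2) ^ n"
  shows "1 / t \<le> 1 + (\<Sum>k\<le>n. if t \<le> (1/2) ^ k then 2 ^ k else 0)"
  using assms
proof (induction n)
  case 0
  then show ?case by simp
next
  case (Suc n)
  show ?case
  proof (cases "t > (1/2) ^ n")
    case True
    then have "1 / t \<le> 1 + (\<Sum>k\<le>n. if t \<le> (1/2) ^ k then 2 ^ k else 0)" by (rule Suc.IH)
    also have "\<dots> \<le> 1 + (\<Sum>k\<le>Suc n. if t \<le> (1/2) ^ k then 2 ^ k else 0)" by simp
    finally show ?thesis .
  next
    case False
    have "t > 0" using Suc.prems by (rule less_trans[rotated]) simp
    have "t \<le> (1/2) ^ k" if "k \<le> n" for k
      using False power_decreasing[OF that, of "1/2::real"] by linarith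
    then have "(\<Sum>k\<le>n. if t \<le> (1/2) ^ k then 2 ^ k else 0) = (\<Sum>k\<le>n. 2 ^ k :: real)"
      by (intro sum.cong) auto
    also have "\<dots> = 2 ^ Suc n - 1" by (induction n) auto
    moreover have "1 / t < 2 ^ Suc n"
      using Suc.prems \<open>t > 0\<close> by (simp add: field_simps)
    moreover have "1 + (\<Sum>k\<le>n. if t \<le> (1/2) ^ k then 2 ^ k else (0::real))
        \<le> 1 + (\<Sum>k\<le>Suc n. if t \<le> (1/2) ^ k then 2 ^ k else 0)" by simp
    ultimately show ?thesis by linarith
  qed
qed

text \<open>The differences of the labels of two dyadic cubes of the same level that touch or coincide.\<close>

definition neighbours :: "(int ^ 'd) set" where
  "neighbours = {v. \<forall>i. v $ i \<in> {-1..1}}"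

lemma finite_neighbours: "finite (neighbours :: (int ^ 'd) set)"
  unfolding neighbours_def by (rule finite_vec_box) simp

text \<open>A ball of radius \<open>(1/2) ^ k\<close> meets only cubes of level \<open>k\<close> that touch the cube of its centre.\<close>

lemma mass_ball_le:
  fixes X :: "(real ^ 'd) set" and a :: real
  assumes X: "finite X" and w: "\<And>x. x \<in> X \<Longrightarrow> w x \<ge> 0"
    and m: "\<And>z. (\<Sum>y | y \<in> X \<and> dyadic k y = z. w y) \<le> a" and a: "a \<ge> 0"
  shows "(\<Sum>y | y \<in> X \<and> norm (x - y) \<le> (1/2) ^ k. w y) \<le> card (neighbours :: (int ^ 'd) set) * a"
proof -
  define Y where "Y = {y \<in> X. norm (x - y) \<le> (1/2) ^ k}"
  have sub: "dyadic k ` Y \<subseteq> (+) (dyadic k x) ` neighbours"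
  proof (rule image_subsetI)
    fix y assume "y \<in> Y"
    have "dyadic k y $ i - dyadic k x $ i \<in> {-1..1}" for i
    proof -
      have "\<bar>x $ i - y $ i\<bar> \<le> (1/2) ^ k"
        using \<open>y \<in> Y\<close> component_le_norm_cart[of "x - y" i] by (simp add: Y_def)
      then have "2 ^ k * \<bar>x $ i - y $ i\<bar> \<le> 1" by (simp add: field_simps)
      then have "\<bar>2 ^ k * x $ i - 2 ^ k * y $ i\<bar> \<le> 1"
        by (simp add: abs_mult flip: right_diff_distrib)
      then show ?thesis unfolding dyadic_nth by simp linarith
    qed
    then show "dyadic k y \<in> (+) (dyadic k x) ` neighbours"
      by (intro image_eqI[of _ _ "dyadic k y - dyadic k x"]) (auto simp: neighbours_def)
  qed
  have finY: "finite Y" using X by (simp add: Y_def)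
  have "sum w Y = (\<Sum>z\<in>dyadic k ` Y. \<Sum>y | y \<in> Y \<and> dyadic k y = z. w y)"
    by (rule sum.image_gen[OF finY])
  also have "\<dots> \<le> (\<Sum>z\<in>dyadic k ` Y. a)"
  proof (rule sum_mono)
    fix z
    have "(\<Sum>y | y \<in> Y \<and> dyadic k y = z. w y) \<le> (\<Sum>y | y \<in> X \<and> dyadic k y = z. w y)"
      using X w by (intro sum_mono2) (auto simp: Y_def)
    then show "(\<Sum>y | y \<in> Y \<and> dyadic k y = z. w y) \<le> a" using m[of z] by linarith
  qed
  also have "\<dots> \<le> card (neighbours :: (int ^ 'd) set) * a"
  proof -
    have "card (dyadic k ` Y) \<le> card ((+) (dyadic k x) ` neighbours)"
      by (rule card_mono[OF _ sub]) (simp add: finite_neighbours)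
    also have "\<dots> \<le> card (neighbours :: (int ^ 'd) set)" by (rule card_image_le[OF finite_neighbours])
    finally show ?thesis using a by (simp add: mult_right_mono)
  qed
  finally show ?thesis unfolding Y_def .
qed
text \<open>At scale \<open>k\<close> a point sees a mass of order \<open>(1/2) powr (s * k)\<close> with kernel \<open>2 ^ k\<close>. Since \<open>s > 1\<close>,
  these contributions form a convergent geometric series, and the bound on the energy does not depend
  on \<open>n\<close>. This is where an exponent greater than 1, and not just a positive one, is essential.\<close>

lemma dyadic_energy_le:
  fixes X :: "(real ^ 'd) set"
  assumes X: "finite X" and w: "\<And>x. x \<in> X \<Longrightarrow> w x \<ge> 0"
    and m: "\<And>k z. k \<le> n \<Longrightarrow> (\<Sum>y | y \<in> X \<and> dyadic k y = z. w y) \<le> (1/2) powr (s * k)"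
    and s: "s > 1" and M: "(\<Sum>x\<in>X. w x) \<le> M"
  shows "(\<Sum>x\<in>X. \<Sum>y\<in>X. w x * w y * (1 + (\<Sum>k\<le>n. if norm (x - y) \<le> (1/2) ^ k then 2 ^ k else 0)))
    \<le> M * (M + card (neighbours :: (int ^ 'd) set) / (1 - (1/2) powr (s - 1)))"
proof -
  let ?P = "real (card (neighbours :: (int ^ 'd) set))"
  define q :: real where "q = (1/2) powr (s - 1)"
  have q: "0 < q" "q < 1" using s by (auto simp: q_def powr_def ln_div)
  have geo: "(\<Sum>k\<le>n. q ^ k) \<le> 1 / (1 - q)"
    using q by (simp add: sum_gp0 divide_right_mono)
  have W0: "(\<Sum>x\<in>X. w x) \<ge> 0" using w by (rule sum_nonneg)
  have point: "(\<Sum>y\<in>X. w y * (1 + (\<Sum>k\<le>n. if norm (x - y) \<le> (1/2) ^ k then 2 ^ k else 0))) \<le> M + ?P / (1 - q)" for x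
  proof -
    have "(\<Sum>y\<in>X. w y * (1 + (\<Sum>k\<le>n. if norm (x - y) \<le> (1/2) ^ k then 2 ^ k else 0)))
        = (\<Sum>y\<in>X. w y) + (\<Sum>y\<in>X. \<Sum>k\<le>n. if norm (x - y) \<le> (1/2) ^ k then 2 ^ k * w y else 0)"
      by (simp add: distrib_left sum.distrib sum_distrib_left if_distrib mult.commute cong: if_cong)
    also have "(\<Sum>y\<in>X. \<Sum>k\<le>n. if norm (x - y) \<le> (1/2) ^ k then 2 ^ k * w y else 0)
        = (\<Sum>k\<le>n. 2 ^ k * (\<Sum>y | y \<in> X \<and> norm (x - y) \<le> (1/2) ^ k. w y))"
      using X by (subst sum.swap) (simp add: sum.inter_filter sum_distrib_left if_distrib cong: if_cong)
    also have "\<dots> \<le> (\<Sum>k\<le>n. ?P * q ^ k)"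
    proof (rule sum_mono)
      fix k assume "k \<in> {..n}"
      then have k: "k \<le> n" by simp
      have "2 ^ k * (\<Sum>y | y \<in> X \<and> norm (x - y) \<le> (1/2) ^ k. w y) \<le> 2 ^ k * (?P * (1/2) powr (s * k))"
        by (rule mult_left_mono, rule mass_ball_le[OF X _ m[OF k]]) (use w in auto)
      also have "(1/2::real) powr (s * k) = q ^ k * (1/2) ^ k"
      proof -
        have "q ^ k = (1/2) powr ((s - 1) * k)"
          using q(1) by (simp add: q_def powr_powr flip: powr_realpow)
        then show ?thesis by (simp add: algebra_simps flip: powr_realpow powr_add)
      qed
      also have "2 ^ k * (?P * (q ^ k * (1/2) ^ k)) = ?P * q ^ k"
        by (simp add: field_simps)
      finally show "2 ^ k * (\<Sum>y | y \<in> X \<and> norm (x - y) \<le> (1/2) ^ k. w y) \<le> ?P * q ^ k" .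
    qed
    also have "\<dots> \<le> ?P / (1 - q)"
      using mult_left_mono[OF geo, of ?P] by (simp add: sum_distrib_left)
    finally show ?thesis using M by linarith
  qed
  have pos: "0 \<le> M + ?P / (1 - q)" using W0 M q by (simp add: add_nonneg_nonneg)
  have "(\<Sum>x\<in>X. \<Sum>y\<in>X. w x * w y * (1 + (\<Sum>k\<le>n. if norm (x - y) \<le> (1/2) ^ k then 2 ^ k else 0)))
      = (\<Sum>x\<in>X. w x * (\<Sum>y\<in>X. w y * (1 + (\<Sum>k\<le>n. if norm (x - y) \<le> (1/2) ^ k then 2 ^ k else 0))))"
    by (simp add: sum_distrib_left mult.assoc)
  also have "\<dots> \<le> (\<Sum>x\<in>X. w x * (M + ?P / (1 - q)))"
    by (intro sum_mono mult_left_mono point w)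
  also have "\<dots> = (\<Sum>x\<in>X. w x) * (M + ?P / (1 - q))" by (simp add: sum_distrib_right)
  also have "\<dots> \<le> M * (M + ?P / (1 - q))" using M pos by (rule mult_right_mono)
  finally show ?thesis unfolding q_def .
qed

text \<open>After interchanging the integral with the sums, it remains to measure, for each pair of points, the
  set of \<open>l\<close> for which the two distances collide. Pairs at a distance up to \<open>(1/2) ^ n\<close> may collide for
  all \<open>l\<close>, which the term \<open>k = n\<close> of the kernel pays for.\<close>

lemma nn_integral_collisions_le:
  fixes X :: "'a::euclidean_space set"
  assumes X: "finite X" "X \<subseteq> cball 0 R" and w: "\<And>x. x \<in> X \<Longrightarrow> w x \<ge> 0" and R: "R > 0"
  shows "(\<integral>\<^sup>+l. ennreal (collisions ((1/2) ^ n) X w (\<lambda>x. norm (l - x))) * indicator (cball 0 R) l \<partial>lborel)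
    \<le> 6 * emeasure lborel (cball (0::'a) (2 * R)) * ennreal
      (\<Sum>x\<in>X. \<Sum>y\<in>X. w x * w y * (1 + (\<Sum>k\<le>n. if norm (x - y) \<le> (1/2) ^ k then 2 ^ k else 0)))"
proof -
  let ?v = "emeasure lborel (cball (0::'a) (2 * R))"
  define r :: real where "r = (1/2) ^ n"
  have r: "r > 0" "1 / r = 2 ^ n" by (auto simp: r_def power_one_over)
  define S where "S x y = {l \<in> cball 0 R. \<bar>norm (l - x) - norm (l - y)\<bar> \<le> r}" for x y :: 'a
  define e where "e x y = 1 + (\<Sum>k\<le>n. if norm (x - y) \<le> (1/2) ^ k then 2 ^ k else (0::real))" for x y :: 'a
  have Sm: "S x y \<in> sets lborel" for x y unfolding S_def by measurable
  have e0: "e x y \<ge> 0" for x y unfolding e_def by (intro add_nonneg_nonneg sum_nonneg) auto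
  have Sle: "ennreal (1 / r) * emeasure lborel (S x y) \<le> 6 * ?v * ennreal (e x y)"
    if xy: "x \<in> X" "y \<in> X" for x y
  proof (cases "norm (x - y) \<le> r")
    case True
    have "(if norm (x - y) \<le> (1/2) ^ n then 2 ^ n else (0::real))
        \<le> (\<Sum>k\<le>n. if norm (x - y) \<le> (1/2) ^ k then 2 ^ k else 0)"
      by (rule member_le_sum) auto
    then have "1 / r \<le> e x y" using True r(2) by (simp add: e_def r_def)
    moreover have "emeasure lborel (S x y) \<le> ?v"
      using R by (intro emeasure_mono) (auto simp: S_def)
    ultimately have "ennreal (1 / r) * emeasure lborel (S x y) \<le> ennreal (e x y) * ?v"
      by (intro mult_mono ennreal_leI) auto
    also have "\<dots> \<le> 6 * (?v * ennreal (e x y))"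
      using mult_right_mono[of 1 "6::ennreal" "?v * ennreal (e x y)"] by (simp add: mult.commute)
    finally show ?thesis by (simp add: mult.assoc)
  next
    case False
    then have "x \<noteq> y" using r by auto
    have le: "1 / norm (x - y) \<le> e x y"
      unfolding e_def by (rule inverse_le_sum_dyadic) (use False in \<open>simp add: r_def\<close>)
    have "emeasure lborel (S x y) \<le> ennreal (6 * r / norm (x - y)) * ?v"
      unfolding S_def using xy X(2) r(1) R \<open>x \<noteq> y\<close> by (intro emeasure_almost_equidistant_le) auto
    then have "ennreal (1 / r) * emeasure lborel (S x y)
        \<le> ennreal (1 / r) * (ennreal (6 * r / norm (x - y)) * ?v)"
      by (rule mult_left_mono) simp
    also have "\<dots> = ennreal (6 * (1 / norm (x - y))) * ?v"
      using r(1) by (simp flip: mult.assoc ennreal_mult)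
    also have "\<dots> \<le> ennreal (6 * e x y) * ?v"
      using le by (intro mult_right_mono ennreal_leI) auto
    also have "\<dots> = 6 * ?v * ennreal (e x y)"
      using e0 by (simp add: ennreal_mult ac_simps)
    finally show ?thesis .
  qed
  have "(\<integral>\<^sup>+l. ennreal (collisions r X w (\<lambda>x. norm (l - x))) * indicator (cball 0 R) l \<partial>lborel)
      = (\<integral>\<^sup>+l. (\<Sum>x\<in>X. \<Sum>y\<in>X. ennreal (w x * w y * (1 / r)) * indicator (S x y) l) \<partial>lborel)"
  proof (rule nn_integral_cong)
    fix l
    show "ennreal (collisions r X w (\<lambda>x. norm (l - x))) * indicator (cball 0 R) l
        = (\<Sum>x\<in>X. \<Sum>y\<in>X. ennreal (w x * w y * (1 / r)) * indicator (S x y) l)"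
    proof (cases "l \<in> cball 0 R")
      case True
      have "collisions r X w (\<lambda>x. norm (l - x)) = (\<Sum>x\<in>X. \<Sum>y\<in>X. w x * w y * (1 / r) * indicator (S x y) l)"
        unfolding collisions_def sum_distrib_left using True
        by (intro sum.cong refl) (auto simp: S_def indicator_def)
      also have "ennreal \<dots> = (\<Sum>x\<in>X. \<Sum>y\<in>X. ennreal (w x * w y * (1 / r) * indicator (S x y) l))"
        using w r(1) by (simp add: sum_nonneg sum_ennreal)
      also have "\<dots> = (\<Sum>x\<in>X. \<Sum>y\<in>X. ennreal (w x * w y * (1 / r)) * indicator (S x y) l)"
        by (intro sum.cong refl) (simp split: split_indicator)
      finally show ?thesis using True by simp
    qed (simp add: S_def)
  qed
  also have "\<dots> = (\<Sum>x\<in>X. \<Sum>y\<in>X. ennreal (w x * w y * (1 / r)) * emeasure lborel (S x y))"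
    using Sm by (simp add: nn_integral_sum nn_integral_cmult)
  also have "\<dots> \<le> (\<Sum>x\<in>X. \<Sum>y\<in>X. 6 * ?v * ennreal (w x * w y * e x y))"
  proof (intro sum_mono)
    fix x y assume xy: "x \<in> X" "y \<in> X"
    have ww: "w x * w y \<ge> 0" using w xy by simp
    have "ennreal (w x * w y * (1 / r)) * emeasure lborel (S x y)
        = ennreal (w x * w y) * (ennreal (1 / r) * emeasure lborel (S x y))"
      using ww r(1) by (subst ennreal_mult) (auto simp: mult.assoc)
    also have "\<dots> \<le> ennreal (w x * w y) * (6 * ?v * ennreal (e x y))"
      using Sle[OF xy] by (rule mult_left_mono) simp
    also have "\<dots> = 6 * ?v * ennreal (w x * w y * e x y)"
      using ww e0[of x y] by (subst ennreal_mult) (auto simp: ac_simps)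
    finally show "ennreal (w x * w y * (1 / r)) * emeasure lborel (S x y) \<le> 6 * ?v * ennreal (w x * w y * e x y)" .
  qed
  also have "\<dots> = 6 * ?v * ennreal (\<Sum>x\<in>X. \<Sum>y\<in>X. w x * w y * e x y)"
    using w e0 by (simp add: sum_nonneg flip: sum_distrib_left sum_ennreal)
  finally show ?thesis unfolding r_def e_def .
qed

section \<open>Pinned distance sets\<close>

text \<open>By the two preceding bounds, the integrals of the collisions over a fixed ball are bounded uniformly
  in \<open>n\<close>, and Fatou's lemma applies. No convergence of the weights is involved.\<close>

lemma AE_liminf_collisions_finite:
  fixes X :: "nat \<Rightarrow> (real ^ 'd) set" and w :: "nat \<Rightarrow> real ^ 'd \<Rightarrow> real" and s :: real
  assumes X: "\<And>n. finite (X n)" "bounded (\<Union>n. X n)" and w: "\<And>n x. x \<in> X n \<Longrightarrow> w n x \<ge> 0"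
    and m: "\<And>n k z. k \<le> n \<Longrightarrow> (\<Sum>y | y \<in> X n \<and> dyadic k y = z. w n y) \<le> (1/2) powr (s * k)"
    and s: "s > 1" and M: "\<And>n. (\<Sum>x\<in>X n. w n x) \<le> M"
  shows "AE l in lborel. liminf (\<lambda>n. ennreal (collisions ((1/2) ^ n) (X n) (w n) (\<lambda>x. norm (l - x)))) < \<infinity>"
proof -
  define I where "I n l = ennreal (collisions ((1/2) ^ n) (X n) (w n) (\<lambda>x. norm (l - x)))" for n and l :: "real ^ 'd"
  have meas[measurable]: "I n \<in> borel_measurable lborel" for n
    unfolding I_def collisions_def by measurable
  obtain b where b: "\<And>x n. x \<in> X n \<Longrightarrow> norm x \<le> b"
    using X(2) unfolding bounded_iff by blast
  define e where "e = M * (M + card (neighbours :: (int ^ 'd) set) / (1 - (1/2) powr (s - 1)))"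
  have "AE l in lborel. l \<in> cball 0 (max 1 b + real j) \<longrightarrow> liminf (\<lambda>n. I n l) < \<infinity>" for j :: nat
  proof -
    \<comment> \<open>A positive radius for which the ball contains all points of all \<open>X n\<close>.\<close>
    define R where "R = max 1 b + real j"
    have R: "R > 0" "b \<le> R" by (auto simp: R_def)
    have [measurable]: "cball (0 :: real ^ 'd) R \<in> sets borel" by simp
    have bound: "(\<integral>\<^sup>+l. I n l * indicator (cball 0 R) l \<partial>lborel)
        \<le> 6 * emeasure lborel (cball (0::real ^ 'd) (2 * R)) * ennreal e" for n
    proof -
      have sub: "X n \<subseteq> cball 0 R" using b R(2) by force
      have "(\<integral>\<^sup>+l. I n l * indicator (cball 0 R) l \<partial>lborel)
        \<le> 6 * emeasure lborel (cball (0::real ^ 'd) (2 * R)) * ennreal (\<Sum>x\<in>X n. \<Sum>y\<in>X n.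
          w n x * w n y * (1 + (\<Sum>k\<le>n. if norm (x - y) \<le> (1/2) ^ k then 2 ^ k else 0)))"
        unfolding I_def by (rule nn_integral_collisions_le[OF X(1) sub w R(1)])
      also have "\<dots> \<le> 6 * emeasure lborel (cball (0::real ^ 'd) (2 * R)) * ennreal e"
        unfolding e_def by (intro mult_left_mono ennreal_leI dyadic_energy_le[OF X(1) w m s M]) auto
      finally show ?thesis .
    qed
    have "(\<integral>\<^sup>+l. liminf (\<lambda>n. I n l * indicator (cball 0 R) l) \<partial>lborel)
        \<le> liminf (\<lambda>n. \<integral>\<^sup>+l. I n l * indicator (cball 0 R) l \<partial>lborel)"
      by (intro nn_integral_liminf) measurable
    also have "\<dots> \<le> limsup (\<lambda>n. \<integral>\<^sup>+l. I n l * indicator (cball 0 R) l \<partial>lborel)"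
      by (rule Liminf_le_Limsup) simp
    also have "\<dots> \<le> 6 * emeasure lborel (cball (0::real ^ 'd) (2 * R)) * ennreal e"
      by (rule Limsup_bounded) (use bound in auto)
    also have "\<dots> < \<infinity>"
      using emeasure_compact_finite[OF compact_cball, of "0::real ^ 'd" "2 * R"]
      by (auto simp: ennreal_mult_less_top)
    finally have "(\<integral>\<^sup>+l. liminf (\<lambda>n. I n l * indicator (cball 0 R) l) \<partial>lborel) \<noteq> \<infinity>" by simp
    then have "AE l in lborel. liminf (\<lambda>n. I n l * indicator (cball 0 R) l) \<noteq> \<infinity>"
      by (intro nn_integral_PInf_AE) measurable
    then show ?thesis
      unfolding R_def[symmetric] by eventually_elim (auto simp: less_top)
  qed
  then have "AE l in lborel. \<forall>j::nat. l \<in> cball 0 (max 1 b + real j) \<longrightarrow> liminf (\<lambda>n. I n l) < \<infinity>"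
    unfolding AE_all_countable by blast
  then show ?thesis
    unfolding I_def[symmetric]
  proof eventually_elim
    case (elim l)
    obtain j :: nat where "norm l \<le> real j" using real_arch_simple by blast
    then have "l \<in> cball 0 (max 1 b + real j)" by simp
    with elim show ?case by blast
  qed
qed

text \<open>If the compact set of distances were null, the measures of its neighbourhoods would tend to zero.
  But for infinitely many \<open>n\<close> the collisions are below a fixed bound, and then the squared mass
  bounds the measure of the neighbourhood at scale \<open>(1/2) ^ n\<close> from below.\<close>

lemma emeasure_pos_if_collisions_bounded:
  fixes K :: "'a::real_normed_vector set" and X :: "nat \<Rightarrow> 'a set" and w :: "nat \<Rightarrow> 'a \<Rightarrow> real"
  assumes K: "compact K" "K \<noteq> {}" and X: "\<And>n. finite (X n)" and w: "\<And>n x. x \<in> X n \<Longrightarrow> w n x \<ge> 0"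
    and near: "\<And>n x. x \<in> X n \<Longrightarrow> \<exists>y\<in>K. dist x y < (1/2) ^ n"
    and t: "t > 0" "\<And>n. t \<le> (\<Sum>x\<in>X n. w n x)"
    and fin: "liminf (\<lambda>n. ennreal (collisions ((1/2) ^ n) (X n) (w n) (\<lambda>x. norm (l - x)))) < \<infinity>"
  shows "emeasure lborel ((\<lambda>y. norm (l - y)) ` K) > 0"
proof (rule ccontr)
  define D where "D = (\<lambda>y. norm (l - y)) ` K"
  \<comment> \<open>One \<open>(1/2) ^ n\<close> for the distance of \<open>X n\<close> from \<open>K\<close>, another one for the radius in the
    collision bound.\<close>
  define B where "B n = {u. infdist u D \<le> 2 * (1/2) ^ n}" for n :: nat
  define I where "I n = ennreal (collisions ((1/2) ^ n) (X n) (w n) (\<lambda>x. norm (l - x)))" for n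
  assume "\<not> ?thesis"
  then have null: "emeasure lborel D = 0" by (simp add: D_def)
  have D: "compact D" "D \<noteq> {}"
    using K unfolding D_def by (auto intro!: compact_continuous_image continuous_intros)
  have cB: "compact (B n)" for n
    unfolding B_def using D by (intro compact_infdist_le) auto
  have "decseq B"
  proof (rule decseq_SucI)
    fix n
    have "2 * (1/2::real) ^ Suc n \<le> 2 * (1/2) ^ n" by simp
    then show "B (Suc n) \<subseteq> B n" unfolding B_def by (auto elim: order_trans)
  qed
  moreover have "(\<Inter>n. B n) = D"
  proof (intro equalityI subsetI INT_I)
    fix u assume u: "u \<in> (\<Inter>n. B n)"
    have "(\<lambda>n. 2 * (1/2::real) ^ n) \<longlonglongrightarrow> 2 * 0" by (intro tendsto_intros LIMSEQ_realpow_zero) auto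
    moreover have "\<forall>n. infdist u D \<le> 2 * (1/2) ^ n" using u by (auto simp: B_def)
    ultimately have "infdist u D \<le> 2 * 0" by (meson LIMSEQ_le_const)
    then have "infdist u D = 0" using infdist_nonneg[of u D] by simp
    then show "u \<in> D" using D compact_imp_closed in_closed_iff_infdist_zero by blast
  qed (auto simp: B_def)
  moreover have "emeasure lborel (B n) < \<infinity>" for n
    using cB emeasure_compact_finite by blast
  ultimately have "(\<lambda>n. emeasure lborel (B n)) \<longlonglongrightarrow> emeasure lborel D"
    using Lim_emeasure_decseq[of B lborel] cB by (auto simp: borel_compact image_subset_iff less_top)
  then have B0: "(\<lambda>n. emeasure lborel (B n)) \<longlonglongrightarrow> 0" unfolding null .
  have main: "ennreal (t\<^sup>2) \<le> emeasure lborel (B n) * I n" for n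
  proof -
    have "{norm (l - x) - (1/2) ^ n..norm (l - x) + (1/2) ^ n} \<subseteq> B n" if x: "x \<in> X n" for x
    proof
      fix u assume u: "u \<in> {norm (l - x) - (1/2) ^ n..norm (l - x) + (1/2) ^ n}"
      obtain y where y: "y \<in> K" "dist x y < (1/2) ^ n" using near[OF x] by blast
      have "infdist u D \<le> dist u (norm (l - y))" using y(1) by (intro infdist_le) (simp add: D_def)
      also have "\<dots> \<le> 2 * (1/2) ^ n"
      proof -
        have "\<bar>norm (l - x) - norm (l - y)\<bar> \<le> dist x y"
          using norm_triangle_ineq3[of "l - x" "l - y"] by (simp add: dist_norm norm_minus_commute)
        moreover have "\<bar>u - norm (l - x)\<bar> \<le> (1/2) ^ n" using u by (auto simp: abs_le_iff)
        ultimately show ?thesis using y(2) unfolding dist_real_def by linarith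
      qed
      finally show "u \<in> B n" by (simp add: B_def)
    qed
    then have "ennreal ((\<Sum>x\<in>X n. w n x)\<^sup>2) \<le> emeasure lborel (B n) * I n"
      unfolding I_def using X w cB
      by (intro square_mass_le_measure_times_collisions) (auto intro: borel_compact)
    moreover have "t\<^sup>2 \<le> (\<Sum>x\<in>X n. w n x)\<^sup>2" using t by (intro power_mono) auto
    ultimately show ?thesis by (meson ennreal_leI order_trans)
  qed
  define c where "c = enn2real (liminf I) + 1"
  have c: "liminf I < ennreal c" "c > 0"
  proof -
    have "liminf I = ennreal (enn2real (liminf I))"
      using fin unfolding I_def[symmetric] by simp
    also have "\<dots> < ennreal c" by (simp add: c_def ennreal_less_iff)
    finally show "liminf I < ennreal c" .
  qed (simp add: c_def add_nonneg_pos)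
  have "\<exists>\<^sub>F n in sequentially. I n < ennreal c"
  proof (rule ccontr)
    assume "\<not> ?thesis"
    then have "\<forall>\<^sub>F n in sequentially. ennreal c \<le> I n" by (simp add: frequently_def not_less)
    then have "ennreal c \<le> liminf I" by (rule Liminf_bounded)
    then show False using c(1) by simp
  qed
  moreover have "\<forall>\<^sub>F n in sequentially. emeasure lborel (B n) < ennreal (t\<^sup>2 / c)"
    using B0 t(1) c(2) by (intro order_tendstoD(2)) auto
  ultimately have "\<exists>\<^sub>F n in sequentially. I n < ennreal c \<and> emeasure lborel (B n) < ennreal (t\<^sup>2 / c)"
    by (rule frequently_eventually_frequently)
  then obtain n where n: "I n < ennreal c" "emeasure lborel (B n) < ennreal (t\<^sup>2 / c)"
    by (auto dest: frequently_ex)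
  have "emeasure lborel (B n) * I n \<le> emeasure lborel (B n) * ennreal c"
    using n(1) by (intro mult_left_mono) auto
  also have "\<dots> < ennreal (t\<^sup>2 / c) * ennreal c"
    using n(2) c(2) by (intro ennreal_mult_strict_right_mono) auto
  also have "\<dots> = ennreal (t\<^sup>2)" using c(2) by (simp flip: ennreal_mult)
  finally show False using main[of n] by simp
qed

text \<open>The content bound concerns open neighbourhoods of \<open>K\<close>, not \<open>K\<close> itself. Therefore the weights of
  level \<open>n\<close> are taken on the neighbourhood of radius \<open>(1/2) ^ n\<close>; their supports approach \<open>K\<close>, which
  is all that the preceding lemma needs.\<close>

lemma AE_distance_image_pos:
  fixes K :: "(real ^ 'd) set" and s :: real
  assumes K: "compact K" and s: "s > 1" and t: "t > 0"
    and cont: "\<And>V. open V \<Longrightarrow> K \<subseteq> V \<Longrightarrow> t < net_content dyadic (level_weight (\<lambda>k. (1/2) powr (s * k))) V"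
  shows "AE l in lborel. emeasure lborel ((\<lambda>y. norm (l - y)) ` K) > 0"
proof -
  define a :: "nat \<Rightarrow> real" where "a k = (1/2) powr (s * k)" for k
  have a: "a k > 0" for k by (simp add: a_def)
  have "t < top" using cont[OF open_UNIV subset_UNIV] by (rule order_less_le_trans) simp
  then obtain t' where t': "t = ennreal t'" "t' > 0" using t by (cases t) auto
  have K0: "K \<noteq> {}"
  proof
    assume "K = {}"
    then have "t < net_content dyadic (level_weight a) ({} :: (real ^ 'd) set)"
      using cont[of "{}"] by (simp add: a_def[abs_def])
    also have "net_content dyadic (level_weight a) ({} :: (real ^ 'd) set) \<le> emeasure (level_weight a :: (nat \<times> (int ^ 'd)) measure) {}"
      by (rule net_content_le) simp
    finally show False by simp
  qed
  define V where "V n = (\<Union>y\<in>K. ball y ((1/2) ^ n))" for n :: nat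
  have V: "open (V n)" "K \<subseteq> V n" for n by (auto simp: V_def)
  have V0: "V n \<subseteq> V 0" for n
  proof -
    have "(1/2::real) ^ n \<le> (1/2) ^ 0" by (rule power_decreasing) auto
    then show ?thesis unfolding V_def by fastforce
  qed
  have bV: "bounded (V 0)"
  proof -
    obtain b where b: "\<And>y. y \<in> K \<Longrightarrow> norm y \<le> b"
      using compact_imp_bounded[OF K] unfolding bounded_iff by blast
    have "norm x \<le> b + 1" if x: "x \<in> V 0" for x
    proof -
      obtain y where "y \<in> K" "dist y x < 1" using x by (auto simp: V_def)
      then show ?thesis using b[of y] norm_triangle_ineq2[of x y]
        by (simp add: dist_norm norm_minus_commute)
    qed
    then show ?thesis unfolding bounded_iff by blast
  qed
  define frostman where "frostman n X w \<longleftrightarrow> finite X \<and> X \<subseteq> V n \<and> (\<forall>x\<in>X. w x \<ge> 0) \<and>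
      (\<forall>k z. k \<le> n \<longrightarrow> (\<Sum>x | x \<in> X \<and> dyadic k x = z. w x) \<le> a k) \<and> t' \<le> (\<Sum>x\<in>X. w x)" for n X w
  have "\<exists>X w. frostman n X w" for n
  proof -
    have fin: "finite (dyadic n ` V n)"
      by (rule finite_dyadic_image) (rule bounded_subset[OF bV V0])
    obtain X :: "(real ^ 'd) set" and w where Xw: "finite X" "X \<subseteq> V n" "\<And>x. x \<in> X \<Longrightarrow> w x \<ge> 0"
      "\<And>k z. k \<le> n \<Longrightarrow> (\<Sum>x | x \<in> X \<and> dyadic k x = z. w x) \<le> a k"
      "net_content dyadic (level_weight a) (V n) \<le> ennreal (\<Sum>x\<in>X. w x)"
      using finite_frostman[of dyadic n "V n" a, OF refining_dyadic fin a] by blast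
    have "ennreal t' < ennreal (\<Sum>x\<in>X. w x)"
      using cont[OF V(1,2)[of n]] Xw(5) unfolding t'(1) a_def[abs_def] by (rule less_le_trans)
    then have "t' \<le> (\<Sum>x\<in>X. w x)" by (meson ennreal_less_iff t'(2) less_imp_le)
    then show ?thesis using Xw(1-4) unfolding frostman_def by blast
  qed
  then obtain X w where "\<And>n. frostman n (X n) (w n)" by metis
  then have X: "\<And>n. finite (X n)" "\<And>n. X n \<subseteq> V n" and w: "\<And>n x. x \<in> X n \<Longrightarrow> w n x \<ge> 0"
      and m: "\<And>n k z. k \<le> n \<Longrightarrow> (\<Sum>x | x \<in> X n \<and> dyadic k x = z. w n x) \<le> a k"
      and mass: "\<And>n. t' \<le> (\<Sum>x\<in>X n. w n x)"
    unfolding frostman_def by simp_all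
  \<comment> \<open>Cubes of level \<open>0\<close> carry mass at most \<open>1\<close>, and only finitely many of them meet \<open>V 0\<close>.\<close>
  have M: "(\<Sum>x\<in>X n. w n x) \<le> card ((dyadic 0 :: real ^ 'd \<Rightarrow> _) ` V 0)" for n
  proof -
    have "(\<Sum>x\<in>X n. w n x) = (\<Sum>z\<in>dyadic 0 ` X n. \<Sum>x | x \<in> X n \<and> dyadic 0 x = z. w n x)"
      by (rule sum.image_gen[OF X(1)])
    also have "\<dots> \<le> (\<Sum>z\<in>dyadic 0 ` X n. 1)"
      using m[of 0 n] by (intro sum_mono) (simp add: a_def)
    also have "\<dots> \<le> card ((dyadic 0 :: real ^ 'd \<Rightarrow> _) ` V 0)"
    proof -
      have "card (dyadic 0 ` X n) \<le> card (dyadic 0 ` V 0)"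
        using X(2)[of n] V0[of n] by (intro card_mono finite_dyadic_image bV image_mono) auto
      then show ?thesis by simp
    qed
    finally show ?thesis .
  qed
  have "bounded (\<Union>n. X n)"
    by (rule bounded_subset[OF bV]) (use X(2) V0 in blast)
  then have "AE l in lborel. liminf (\<lambda>n. ennreal (collisions ((1/2) ^ n) (X n) (w n) (\<lambda>x. norm (l - x)))) < \<infinity>"
    using m unfolding a_def by (intro AE_liminf_collisions_finite[OF X(1) _ w _ s M]) auto
  then show ?thesis
  proof eventually_elim
    case (elim l)
    have "\<exists>y\<in>K. dist x y < (1/2) ^ n" if "x \<in> X n" for x n
      using X(2)[of n] that by (force simp: V_def dist_commute)
    then show ?case
      by (intro emeasure_pos_if_collisions_bounded[OF K K0 X(1) w _ t'(2) mass elim]) auto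
  qed
qed

lemma hausdorff_dim_gt_imp_measure_pos:
  assumes "hausdorff_dim E > ennreal s" "s \<ge> 0"
  obtains s' where "s' > s" "hausdorff_measure s' E > 0"
proof -
  obtain s' where s': "s' > s" "ennreal s' < hausdorff_dim E"
  proof -
    obtain x where x: "ennreal s < x" "x < hausdorff_dim E" using dense[OF assms(1)] by blast
    then have "x < top" by (meson order_less_le_trans top_greatest)
    then obtain s' where "x = ennreal s'" "s' \<ge> 0" by (cases x) auto
    then show ?thesis using that x assms(2) by (simp add: ennreal_less_iff)
  qed
  have "hausdorff_measure s' E \<noteq> 0"
  proof
    assume "hausdorff_measure s' E = 0"
    then have "hausdorff_dim E \<le> ennreal s'"
      unfolding hausdorff_dim_def using s'(1) assms(2) by (intro INF_lower) auto
    then show False using s'(2) by simp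
  qed
  then show ?thesis using that s'(1) by (simp add: zero_less_iff_neq_zero)
qed

theorem theorem3p2:
  fixes E :: "(real ^ 'd) set"
  assumes "CARD('d) \<ge> 2"
    and "analytic_set E"
    and "hausdorff_dim E > 1"
  shows "AE l in lebesgue. pinned_distances l E \<in> sets lebesgue
           \<and> emeasure lebesgue (pinned_distances l E) > 0"
proof -
  obtain s where s: "s > 1" "hausdorff_measure s E > 0"
    using hausdorff_dim_gt_imp_measure_pos[of 1 E] assms(3) by auto
  define \<nu> :: "(nat \<times> (int ^ 'd)) measure" where "\<nu> = level_weight (\<lambda>k. (1/2) powr (s * k))"
  have pos: "net_content dyadic \<nu> E > 0"
    unfolding \<nu>_def using s by (intro net_content_pos_if_hausdorff_measure_pos) auto
  then obtain t where t: "0 < t" "t < net_content dyadic \<nu> E" using dense by blast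
  have "E \<noteq> {}"
  proof
    assume "E = {}"
    then have "net_content dyadic \<nu> E \<le> emeasure \<nu> {}" by (intro net_content_le) simp
    then show False using pos by simp
  qed
  then obtain f :: "(nat \<Rightarrow> nat) \<Rightarrow> real ^ 'd" where f: "continuous_on UNIV f" "range f = E"
    using assms(2) unfolding analytic_set_def by blast
  obtain K where K: "compact K" "K \<subseteq> range f"
      "\<And>V. open V \<Longrightarrow> K \<subseteq> V \<Longrightarrow> t < net_content dyadic \<nu> V"
  proof (rule capacity_inner_compact[OF f(1), of "net_content dyadic \<nu>" t])
    show "net_content dyadic \<nu> (\<Union>i. A i) \<le> (SUP i. net_content dyadic \<nu> (A i))"
      if "incseq A" for A :: "nat \<Rightarrow> (real ^ 'd) set"
      by (rule net_content_incseq[OF refining_dyadic _ that]) (simp add: \<nu>_def sets_level_weight)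
  qed (use t f in \<open>auto intro: net_content_mono\<close>)
  have pd: "pinned_distances l A = (\<lambda>y. norm (l - y)) ` A" for l and A :: "(real ^ 'd) set"
    by (auto simp: pinned_distances_def)
  have meas: "pinned_distances l E \<in> sets lebesgue" for l
    unfolding pd by (intro analytic_set_imp_lebesgue analytic_set_image assms(2) continuous_intros)
  have "AE l in lborel. emeasure lborel ((\<lambda>y. norm (l - y)) ` K) > 0"
    by (rule AE_distance_image_pos[OF K(1) s(1) t(1)]) (use K(3) in \<open>simp add: \<nu>_def\<close>)
  then have "AE l in lebesgue. emeasure lborel ((\<lambda>y. norm (l - y)) ` K) > 0"
    by (rule AE_completion)
  then show ?thesis
  proof eventually_elim
    case (elim l)
    have "compact ((\<lambda>y. norm (l - y)) ` K)"
      using K(1) by (intro compact_continuous_image continuous_intros)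
    then have "(\<lambda>y. norm (l - y)) ` K \<in> sets borel" by (rule borel_compact)
    then have "emeasure lborel ((\<lambda>y. norm (l - y)) ` K) = emeasure lebesgue ((\<lambda>y. norm (l - y)) ` K)"
      by simp
    also have "\<dots> \<le> emeasure lebesgue (pinned_distances l E)"
      using K(2) f(2) meas by (intro emeasure_mono) (auto simp: pd)
    finally show ?case using elim meas by (metis less_le_trans)
  qed
qed

end
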